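(* Let $v$ be a velocity function satisfying (V1), with Lipschitz constant $L$. For every integer $N\ge1$ let $\{x_j^N(t)\}_{j=0}^N$ and $\{\tilde x_j^N(t)\}_{j=0}^N$ be two solutions of the Follow-the-Leader system with $N+1$ vehicles, and assume that there is a bounded set $K\subset\mathbb{R}$ such that $x_i^N(0),\tilde x_i^N(0)\in K$ for all $i=0,\dots,N$ and all $N$. Let $\rho^{E,N},\tilde\rho^{E,N}\in L^\infty([0,+\infty)\times\mathbb{R};[0,1])$ be the corresponding Eulerian discrete densities. Then, for all $T>0$ and all $N$, $$\sup_{t\in[0,T]}W_1(\rho^{E,N}(t),\tilde\rho^{E,N}(t))\le W_1(\rho^{E,N}(0),\tilde\rho^{E,N}(0))+2LT\sum_{j=0}^{N-1}\big|x^N_{j+1}(0)-x^N_j(0)-(\tilde x^N_{j+1}(0)-\tilde x^N_j(0))\big|.$$ Moreover, if $x_N^N(0)=\tilde x_N^N(0)$ for all $N$ and $$\lim_{N\to+\infty}\sum_{j=0}^{N-1}\big|x^N_{j+1}(0)-x^N_j(0)-(\tilde x^N_{j+1}(0)-\tilde x^N_j(0))\big|=0,$$ then the following two properties hold: (i) if there exists $C>0$ such that $\mathrm{TV}(\rho^{E,N}(0);\mathbb{R})<C$ and $\mathrm{TV}(\tilde\rho^{E,N}(0);\mathbb{R})<C$ for all $N$, then for all $T>0$ $$\lim_{N\to+\infty}\ \sup_{t\in[0,T]}\|\rho^{E,N}(t)-\tilde\rho^{E,N}(t)\|_{L^1(\mathbb{R})}=0;$$ (ii) if $v$ satisfies (V2),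 then for all $T>0$ there holds $$\lim_{k\to+\infty}\ \sup_{t\in[1/k,T]}\|\rho^{E,N_k}(t)-\tilde\rho^{E,N_k}(t)\|_{L^1(\mathbb{R})}=0$$ for some subsequences $\{\rho^{E,N_k}\}_k$, $\{\tilde\rho^{E,N_k}\}_k$ (along a common strictly increasing sequence of indices $N_k$).
   Context: Velocity assumptions, with $\rho_{\max}:=1$: (V1) $v:[0,1]\to\mathbb{R}$ is Lipschitz continuous with Lipschitz constant $L$, $v(1)=0$, and there is a constant $c<0$ with $v'(\rho)\le c$ for a.e. $\rho\in[0,1]$. Set $v_{\max}:=v(0)$. (V2) The map $\rho\mapsto\rho\,v'(\rho)$ is non-increasing on $[0,1]$ (where $v'$ is defined). Follow-the-Leader (FtL) system: for $N\ge1$ and $l:=1/N$, the positions satisfy $$\dot x_N^N=v_{\max},\qquad \dot x_j^N=v\!\left(\frac{l}{x^N_{j+1}-x^N_j}\right),\quad j=0,\dots,N-1,\qquad t\ge 0,$$ with initial positions $x_0^N(0)<\dots<x_N^N(0)$ satisfying $x^N_{j+1}(0)-x^N_j(0)\ge l$ for $j=0,\dots,N-1$ (this spacing is preserved for all $t\ge0$). Both $\{x_j^N\}$ and $\{\tilde x_j^N\}$ are of this kind. Eulerian discrete density: $$\rho^{E,N}(t,x):=\sum_{j=0}^{N-1}\frac{l}{x^N_{j+1}(t)-x^N_j(t)}\,\chi_{[x^N_j(t),x^N_{j+1}(t))}(x),$$ where $\chi_A$ is the indicator function of $A$; $\tilde\rho^{E,N}$ is defined in the same way from $\{\tilde x_j^N\}$.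 For each $t$ these are probability densities with compact support. $W_1$ is the 1-Wasserstein distance on $\mathbb{R}$: for compactly supported probability measures $\mu,\nu$, $W_1(\mu,\nu)=\|F_\mu-F_\nu\|_{L^1(\mathbb{R})}=\|X_\mu-X_\nu\|_{L^1([0,1])}$, where $F_\mu(x)=\mu((-\infty,x])$ and $X_\mu(z)=\inf\{x\in\mathbb{R}: F_\mu(x)\ge z\}$. $\mathrm{TV}(\cdot;\mathbb{R})$ denotes total variation on $\mathbb{R}$. *)

theory Defs
  imports "HOL-Analysis.Analysis" "HOL-Probability.Probability"
begin

(* The derivative v' is taken relative to the domain [0,1]. The almost everywhere bound includes
   that v' exists almost everywhere, as it does for every Lipschitz function. *)
definition V1 :: "real \<Rightarrow> (real \<Rightarrow> real) \<Rightarrow> bool" where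
  "V1 L v \<longleftrightarrow> L-lipschitz_on {0..1} v \<and> v 1 = 0 \<and>
    (\<exists>c<0. AE r in lborel. r \<in> {0..1} \<longrightarrow>
       (\<exists>d\<le>c. (v has_real_derivative d) (at r within {0..1})))"

definition V2 :: "(real \<Rightarrow> real) \<Rightarrow> bool" where
  "V2 v \<longleftrightarrow> (\<forall>r s d e. 0 \<le> r \<and> r \<le> s \<and> s \<le> 1 \<and>
      (v has_real_derivative d) (at r within {0..1}) \<and>
      (v has_real_derivative e) (at s within {0..1}) \<longrightarrow> s * e \<le> r * d)"

(* x j t is the position of vehicle j (0 <= j <= N) at time t >= 0, and the mass per vehicle
   is 1/N. Since the velocity has domain [0,1], solving the equations includes that its argument
   lies in [0,1]; values of v outside [0,1] are never used. *)
definition ftl_solution :: "(real \<Rightarrow> real) \<Rightarrow> nat \<Rightarrow> (nat \<Rightarrow> real \<Rightarrow> real) \<Rightarrow> bool" where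
  "ftl_solution v N x \<longleftrightarrow>
    (\<forall>j<N. x j 0 < x (Suc j) 0 \<and> 1 / real N \<le> x (Suc j) 0 - x j 0) \<and>
    (\<forall>t\<ge>0. \<forall>j<N. x j t < x (Suc j) t \<and>
       (1 / real N) / (x (Suc j) t - x j t) \<in> {0..1}) \<and>
    (\<forall>t\<ge>0. (x N has_real_derivative v 0) (at t within {0..})) \<and>
    (\<forall>t\<ge>0. \<forall>j<N. (x j has_real_derivative v ((1 / real N) / (x (Suc j) t - x j t)))
       (at t within {0..}))"

definition eulerian_density :: "nat \<Rightarrow> (nat \<Rightarrow> real \<Rightarrow> real) \<Rightarrow> real \<Rightarrow> real \<Rightarrow> real" where
  "eulerian_density N x t y =
    (\<Sum>j<N. (1 / real N) / (x (Suc j) t - x j t) * indicator {x j t..<x (Suc j) t} y)"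

(* On the real line, for compactly supported probability measures, the 1-Wasserstein distance
   is the L^1 distance of the distribution functions. *)
definition W1_dist :: "real measure \<Rightarrow> real measure \<Rightarrow> ennreal" where
  "W1_dist M M' = (\<integral>\<^sup>+y. ennreal \<bar>cdf M y - cdf M' y\<bar> \<partial>lborel)"

definition W1 :: "(real \<Rightarrow> real) \<Rightarrow> (real \<Rightarrow> real) \<Rightarrow> ennreal" where
  "W1 f g = W1_dist (density lborel (\<lambda>y. ennreal (f y))) (density lborel (\<lambda>y. ennreal (g y)))"

definition L1_norm :: "(real \<Rightarrow> real) \<Rightarrow> ennreal" where
  "L1_norm f = (\<integral>\<^sup>+y. ennreal \<bar>f y\<bar> \<partial>lborel)"

(* Pointwise variation. It agrees with the total variation of the L^1 class of f when f is a
   right-continuous step function, as the densities above are. *)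
definition TV :: "(real \<Rightarrow> real) \<Rightarrow> ennreal" where
  "TV f = (SUP (n, p) \<in> {(n :: nat, p :: nat \<Rightarrow> real). mono p}.
     \<Sum>i<n. ennreal \<bar>f (p (Suc i)) - f (p i)\<bar>)"

definition gap_diff :: "nat \<Rightarrow> (nat \<Rightarrow> real \<Rightarrow> real) \<Rightarrow> (nat \<Rightarrow> real \<Rightarrow> real) \<Rightarrow> real" where
  "gap_diff N x x' = (\<Sum>j<N. \<bar>x (Suc j) 0 - x j 0 - (x' (Suc j) 0 - x' j 0)\<bar>)"

end

theory Submission
  imports Defs
begin

text \<open>Write \<open>y\<^sub>j\<close> for the gaps, \<open>r\<^sub>j\<close> for the densities \<open>1 / (N * y\<^sub>j)\<close>, with \<open>r\<^sub>N = 0\<close>, and \<open>D\<close> for the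
  \<open>\<ell>\<^sub>1\<close> distance of the initial gaps. Since \<open>x\<^sub>j' = v r\<^sub>j\<close> for every vehicle, the gaps satisfy
  \<open>y\<^sub>j' = v r\<^sub>j\<^sub>+\<^sub>1 - v r\<^sub>j\<close>. This is a conservation law in the vehicle label, with a flux that is
  monotone in the gap.

  Contraction. The difference of the gaps of two solutions obeys a law of the form
  \<open>u\<^sub>j' = e\<^sub>j\<^sub>+\<^sub>1 - e\<^sub>j\<close> in which \<open>e\<^sub>j\<close> has the sign of \<open>u\<^sub>j\<close> and \<open>e\<^sub>N = 0\<close>, and for such laws
  \<open>\<Sum>\<^sub>j \<bar>u\<^sub>j\<bar>\<close> does not increase (\<open>sum_abs_flux_nonincreasing\<close>). So the gaps stay at distance at most
  \<open>D\<close> (\<open>gap_dist_contraction\<close>). The increments of \<open>r\<^sub>j\<close> obey a law of the same form, with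
  \<open>e\<^sub>j = r\<^sub>j'\<close>, so the variation of the density does not increase either (\<open>variation_decreasing\<close>).

  Wasserstein distance. Two velocities differ by at most \<open>L * N\<close> times the difference of the gaps.
  By the contraction the differences of the positions therefore change, in time \<open>t\<close>, by at most
  \<open>L * t * D\<close> on average over the vehicles. The positions are the quantiles of the density at the
  multiples of \<open>1 / N\<close>, and the distance is the integral of the difference of the quantile
  functions (\<open>W1_quantile\<close>), whence \<open>W1_growth\<close>.

  Norm. If the leaders coincide, so do they at all times, and each position differs by at most \<open>D\<close>.
  Summation by parts writes the density as a combination of unit steps at the positions, with
  coefficients \<open>r\<^sub>0 \<le> 1\<close> and \<open>r\<^sub>j\<^sub>+\<^sub>1 - r\<^sub>j\<close>. If the latter have sum \<open>V\<close> in absolute value, displacing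
  the steps costs at most \<open>D * (1 + V)\<close>, and adjusting the heights costs at most \<open>D\<close>
  (\<open>L1_norm_density_diff\<close>). With a bound on the initial
  variation the distance tends to \<open>0\<close> together with \<open>D\<close>.

  Smoothing. Without such a bound, (V2) yields the one-sided estimate \<open>y\<^sub>j' \<le> y\<^sub>j / t\<close>
  (\<open>gap_rate_le\<close>), a discrete Oleinik condition, which makes the variation at time \<open>t\<close> of order
  \<open>1 / t\<close> (\<open>variation_smoothing\<close>). At times after \<open>1 / k\<close> it is of order \<open>k\<close>, and the product
  with \<open>D\<close> tends to \<open>0\<close> along a subsequence on which \<open>D\<close> is at most \<open>1 / k\<^sup>2\<close>.

  The velocity is only Lipschitz. A function of this kind grows by at most the bound on its
  derivative almost everywhere (\<open>lipschitz_AE_slope_le\<close>); this gives that \<open>v\<close> decreases at a definite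
  rate and turns (V2) into a comparison of finite differences (\<open>V2_scaling\<close>).\<close>

section \<open>Growth from one-sided slopes\<close>

lemma last_crossing:
  fixes g :: "real \<Rightarrow> real"
  assumes cont: "continuous_on {a..b} g" and ab: "a \<le> b" and w: "g a \<le> w" "w < g b"
  obtains s where "a \<le> s" "s < b" "g s = w" "\<And>t. s < t \<Longrightarrow> t \<le> b \<Longrightarrow> w < g t"
proof -
  define S where "S = {t \<in> {a..b}. g t \<le> w}"
  have S_alt: "S = {a..b} \<inter> S" and "S = {a..b} \<inter> g -` {..w}"
    unfolding S_def by auto
  then have "closed S"
    using continuous_closed_preimage[OF cont closed_atLeastAtMost closed_atMost, of w] by simp
  then have "compact S"
    using compact_Int_closed[OF compact_Icc, of S a b] S_alt by simp
  moreover have "a \<in> S" using w ab by (simp add: S_def)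
  ultimately obtain s where s: "s \<in> S" and last: "\<And>t. t \<in> S \<Longrightarrow> t \<le> s"
    using compact_attains_sup[of S] by blast
  have sab: "a \<le> s" "s \<le> b" and gs: "g s \<le> w" using s by (auto simp: S_def)
  have above: "w < g t" if "s < t" "t \<le> b" for t
  proof (rule ccontr)
    assume "\<not> w < g t"
    then have "t \<in> S" using that sab by (simp add: S_def)
    then show False using last[of t] that by simp
  qed
  have "s < b" using gs w sab by (cases "s = b") auto
  have "continuous_on {s..b} g" by (rule continuous_on_subset[OF cont]) (use sab in auto)
  then obtain t where t: "s \<le> t" "t \<le> b" "g t = w"
    using IVT'[of g s w b] gs w sab by auto
  then have "t = s" using above[of t] by (cases "s < t") auto
  then show thesis using that[of s] sab \<open>s < b\<close> t above by simp
qed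

text \<open>Suppose \<open>f\<close> grows by more and let \<open>m > c\<close> be a slope that is still exceeded. The values of
  \<open>g t = f t - m * t\<close> strictly between \<open>g a\<close> and \<open>g b\<close> are each attained for a
  last time, and after a last time \<open>g\<close> lies above the value. A growth bound to the right excludes
  this outside \<open>E\<close>, so the whole interval of values would lie in the null set \<open>g ` E\<close>. With
  \<open>E = {}\<close> this is the comparison principle for right Dini derivatives.\<close>

lemma right_growth_le:
  fixes f :: "real \<Rightarrow> real"
  assumes ab: "a \<le> b" and cont: "continuous_on {a..b} f"
    and null: "\<And>m. negligible ((\<lambda>t. f t - m * t) ` E)"
    and growth: "\<And>t e. a \<le> t \<Longrightarrow> t < b \<Longrightarrow> t \<notin> E \<Longrightarrow> 0 < e \<Longrightarrow>
      \<forall>\<^sub>F s in at_right t. f s - f t \<le> (c + e) * (s - t)"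
  shows "f b - f a \<le> c * (b - a)"
proof (rule ccontr)
  assume contra: "\<not> ?thesis"
  then have "a < b" using ab by (cases "a = b") auto
  define e where "e = (f b - f a - c * (b - a)) / (2 * (b - a))"
  have e: "0 < e" using contra \<open>a < b\<close> by (simp add: e_def)
  have e2: "2 * (e * (b - a)) = f b - f a - c * (b - a)"
    using \<open>a < b\<close> by (simp add: e_def field_simps)
  define g where "g = (\<lambda>t. f t - (c + e) * t)"
  have cont_g: "continuous_on {a..b} g"
    unfolding g_def by (intro continuous_intros cont)
  have g_ba: "g b - g a = e * (b - a)"
    using e2 by (simp add: g_def algebra_simps)
  moreover have "0 < e * (b - a)" using e \<open>a < b\<close> by simp
  ultimately have "g a < g b" by linarith
  have "{g a<..<g b} \<subseteq> g ` E"
  proof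
    fix w assume w: "w \<in> {g a<..<g b}"
    obtain s where s: "a \<le> s" "s < b" "g s = w" and above: "\<And>t. s < t \<Longrightarrow> t \<le> b \<Longrightarrow> w < g t"
      by (rule last_crossing[OF cont_g ab, of w]) (use w in auto)
    have "s \<in> E"
    proof (rule ccontr)
      assume "s \<notin> E"
      then have "\<forall>\<^sub>F u in at_right s. f u - f s \<le> (c + e) * (u - s)"
        by (rule growth[OF s(1,2) _ e])
      moreover have "\<forall>\<^sub>F u in at_right s. u < b \<and> s < u"
        using order_tendstoD(2)[OF tendsto_ident_at s(2)] eventually_at_right_less
        by (rule eventually_conj)
      ultimately have "\<forall>\<^sub>F u in at_right s. f u - f s \<le> (c + e) * (u - s) \<and> u < b \<and> s < u"
        by (rule eventually_conj)
      from eventually_happens[OF this]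
      obtain u where u: "f u - f s \<le> (c + e) * (u - s)" "u < b" "s < u"
        by auto
      have "g u \<le> g s" using u(1) by (simp add: g_def algebra_simps)
      then show False using above[of u] u s by simp
    qed
    then show "w \<in> g ` E" using s(3) by blast
  qed
  then have "negligible {g a<..<g b}"
    using null[of "c + e"] negligible_subset unfolding g_def by blast
  then show False
    using \<open>g a < g b\<close> negligible_interval(2)[of "g a" "g b"] by simp
qed

lemma eventually_right_slope:
  fixes f :: "real \<Rightarrow> real"
  assumes der: "(f has_real_derivative d) (at t within S)"
    and S: "t < u" "{t..u} \<subseteq> S" and k: "d < k"
  shows "\<forall>\<^sub>F s in at_right t. f s - f t \<le> k * (s - t)"
proof -
  have "(f has_real_derivative d) (at t within {t..u})"
    by (rule DERIV_subset[OF der S(2)])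
  then have "((\<lambda>s. (f s - f t) / (s - t)) \<longlongrightarrow> d) (at_right t)"
    using at_within_Icc_at_right[OF S(1)] by (simp add: has_field_derivative_iff)
  then have "\<forall>\<^sub>F s in at_right t. (f s - f t) / (s - t) < k"
    using k by (rule order_tendstoD(2))
  then show ?thesis
    using eventually_at_right_less[of t]
    by eventually_elim (simp add: divide_less_eq)
qed

lemma growth_le_of_deriv:
  fixes f :: "real \<Rightarrow> real"
  assumes der: "\<And>t. 0 \<le> t \<Longrightarrow> (f has_real_derivative d t) (at t within {0..})"
    and ab: "0 \<le> a" "a \<le> b"
    and slope: "\<And>t. a \<le> t \<Longrightarrow> t < b \<Longrightarrow> d t \<le> c"
  shows "f b - f a \<le> c * (b - a)"
proof (rule right_growth_le[where E = "{}", OF ab(2)])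
  have "continuous_on {0..} f"
    by (rule DERIV_continuous_on[of _ _ d]) (rule der, simp)
  then show "continuous_on {a..b} f"
    by (rule continuous_on_subset) (use ab in auto)
  fix t e :: real assume t: "a \<le> t" "t < b" and e: "0 < e"
  show "\<forall>\<^sub>F s in at_right t. f s - f t \<le> (c + e) * (s - t)"
    by (rule eventually_right_slope[OF der, of t "t + 1"]) (use t ab e slope[OF t] in auto)
qed simp

text \<open>Where \<open>f\<close> vanishes, \<open>\<bar>f\<bar>\<close> still has a right derivative, namely \<open>\<bar>d\<bar>\<close>.\<close>

definition abs_slope :: "real \<Rightarrow> real \<Rightarrow> real" where
  "abs_slope y d = (if y = 0 then \<bar>d\<bar> else sgn y * d)"

lemma abs_slope_le: "abs_slope y d \<le> \<bar>d\<bar>"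
  by (auto simp: abs_slope_def sgn_if)

lemma eventually_right_slope_abs:
  fixes f :: "real \<Rightarrow> real"
  assumes der: "(f has_real_derivative d) (at t within S)"
    and S: "t < u" "{t..u} \<subseteq> S" and k: "abs_slope (f t) d < k"
  shows "\<forall>\<^sub>F s in at_right t. \<bar>f s\<bar> - \<bar>f t\<bar> \<le> k * (s - t)"
proof -
  have der': "((\<lambda>s. - f s) has_real_derivative - d) (at t within S)"
    using der by (rule DERIV_minus)
  have "(f has_real_derivative d) (at t within {t..u})"
    by (rule DERIV_subset[OF der S(2)])
  then have "continuous (at t within {t..u}) f"
    by (rule DERIV_continuous)
  then have tends: "(f \<longlongrightarrow> f t) (at_right t)"
    using at_within_Icc_at_right[OF S(1)] by (simp add: continuous_within)
  consider "f t = 0" | "0 < f t" | "f t < 0" by linarith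
  then show ?thesis
  proof cases
    case 1
    have "d < k" "- d < k" using k 1 by (auto simp: abs_slope_def)
    from eventually_right_slope[OF der S this(1)] eventually_right_slope[OF der' S this(2)]
    show ?thesis by eventually_elim (use 1 in auto)
  next
    case 2
    have "d < k" using k 2 by (auto simp: abs_slope_def)
    from eventually_right_slope[OF der S this] order_tendstoD(1)[OF tends 2]
    show ?thesis by eventually_elim (use 2 in auto)
  next
    case 3
    have "- d < k" using k 3 by (auto simp: abs_slope_def)
    from eventually_right_slope[OF der' S this] order_tendstoD(2)[OF tends 3]
    show ?thesis by eventually_elim (use 3 in auto)
  qed
qed

lemma sum_abs_growth:
  fixes u d :: "nat \<Rightarrow> real \<Rightarrow> real"
  assumes der: "\<And>j t. j < n \<Longrightarrow> 0 \<le> t \<Longrightarrow> (u j has_real_derivative d j t) (at t within {0..})"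
    and ab: "0 \<le> a" "a \<le> b"
    and slope: "\<And>t. a \<le> t \<Longrightarrow> t < b \<Longrightarrow> (\<Sum>j<n. abs_slope (u j t) (d j t)) \<le> B"
  shows "(\<Sum>j<n. \<bar>u j b\<bar>) \<le> (\<Sum>j<n. \<bar>u j a\<bar>) + B * (b - a)"
proof -
  have "(\<Sum>j<n. \<bar>u j b\<bar>) - (\<Sum>j<n. \<bar>u j a\<bar>) \<le> B * (b - a)"
  proof (rule right_growth_le[where E = "{}"])
    show "continuous_on {a..b} (\<lambda>t. \<Sum>j<n. \<bar>u j t\<bar>)"
    proof (intro continuous_on_sum continuous_on_rabs)
      fix j assume "j \<in> {..<n}"
      then have "continuous_on {0..} (u j)"
        by (intro DERIV_continuous_on[of _ _ "d j"] der) auto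
      then show "continuous_on {a..b} (u j)"
        by (rule continuous_on_subset) (use ab in auto)
    qed
    fix t e :: real assume t: "a \<le> t" "t < b" and e: "0 < e"
    define h where "h = e / (real n + 1)"
    have h: "0 < h" using e by (simp add: h_def)
    have "\<forall>\<^sub>F s in at_right t. \<forall>j\<in>{..<n}.
        \<bar>u j s\<bar> - \<bar>u j t\<bar> \<le> (abs_slope (u j t) (d j t) + h) * (s - t)"
    proof (rule eventually_ball_finite, simp, rule ballI)
      fix j assume j: "j \<in> {..<n}"
      show "\<forall>\<^sub>F s in at_right t.
          \<bar>u j s\<bar> - \<bar>u j t\<bar> \<le> (abs_slope (u j t) (d j t) + h) * (s - t)"
        by (rule eventually_right_slope_abs[OF der, of j t "t + 1"]) (use j t ab h in auto)
    qed
    then show "\<forall>\<^sub>F s in at_right t.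
        (\<Sum>j<n. \<bar>u j s\<bar>) - (\<Sum>j<n. \<bar>u j t\<bar>) \<le> (B + e) * (s - t)"
      using eventually_at_right_less[of t]
    proof eventually_elim
      case (elim s)
      have "(\<Sum>j<n. \<bar>u j s\<bar>) - (\<Sum>j<n. \<bar>u j t\<bar>) = (\<Sum>j<n. \<bar>u j s\<bar> - \<bar>u j t\<bar>)"
        by (simp add: sum_subtractf)
      also have "\<dots> \<le> (\<Sum>j<n. (abs_slope (u j t) (d j t) + h) * (s - t))"
        by (rule sum_mono) (use elim in auto)
      also have "\<dots> = ((\<Sum>j<n. abs_slope (u j t) (d j t)) + real n * h) * (s - t)"
        by (simp add: sum_distrib_right[symmetric] sum.distrib)
      also have "\<dots> \<le> (B + e) * (s - t)"
      proof (rule mult_right_mono)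
        have "real n * h \<le> e" using e by (simp add: h_def field_simps)
        then show "(\<Sum>j<n. abs_slope (u j t) (d j t)) + real n * h \<le> B + e"
          using slope[OF t] by linarith
      qed (use elim in simp)
      finally show ?case .
    qed
  qed (use ab in auto)
  then show ?thesis by simp
qed

text \<open>For a system in flux form whose flux \<open>e j\<close> out of cell \<open>j\<close> has the sign of \<open>u j\<close>, the cell
  loses \<open>\<bar>e j\<bar>\<close> of its absolute value and gains at most \<open>\<bar>e (Suc j)\<bar>\<close>, so the total can only
  decrease. This one principle gives both the contraction of the distance between two solutions
  and the decay of the variation of one.\<close>

lemma sum_abs_flux_nonincreasing:
  fixes u e :: "nat \<Rightarrow> real \<Rightarrow> real"
  assumes der: "\<And>j t. j < n \<Longrightarrow> 0 \<le> t \<Longrightarrow>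
      (u j has_real_derivative e (Suc j) t - e j t) (at t within {0..})"
    and sign: "\<And>j t. j < n \<Longrightarrow> 0 \<le> t \<Longrightarrow> e j t = \<bar>e j t\<bar> * sgn (u j t)"
    and last: "\<And>t. 0 \<le> t \<Longrightarrow> e n t = 0"
    and ab: "0 \<le> a" "a \<le> b"
  shows "(\<Sum>j<n. \<bar>u j b\<bar>) \<le> (\<Sum>j<n. \<bar>u j a\<bar>)"
proof -
  have "(\<Sum>j<n. \<bar>u j b\<bar>) \<le> (\<Sum>j<n. \<bar>u j a\<bar>) + 0 * (b - a)"
  proof (rule sum_abs_growth[OF der])
    fix t assume t: "a \<le> t" "t < b"
    have "(\<Sum>j<n. abs_slope (u j t) (e (Suc j) t - e j t)) \<le> (\<Sum>j<n. \<bar>e (Suc j) t\<bar> - \<bar>e j t\<bar>)"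
    proof (rule sum_mono)
      fix j assume "j \<in> {..<n}"
      then have "e j t = \<bar>e j t\<bar> * sgn (u j t)" using sign t ab by simp
      then show "abs_slope (u j t) (e (Suc j) t - e j t) \<le> \<bar>e (Suc j) t\<bar> - \<bar>e j t\<bar>"
        by (auto simp: abs_slope_def sgn_if split: if_splits)
    qed
    also have "\<dots> = \<bar>e n t\<bar> - \<bar>e 0 t\<bar>" by (rule sum_lessThan_telescope)
    also have "\<dots> \<le> 0" using last t ab by simp
    finally show "(\<Sum>j<n. abs_slope (u j t) (e (Suc j) t - e j t)) \<le> 0" .
  qed (use ab in auto)
  then show ?thesis by simp
qed

section \<open>The velocity function\<close>

lemma lipschitz_AE_slope_le:
  fixes f :: "real \<Rightarrow> real"
  assumes ab: "a \<le> b" and lip: "C-lipschitz_on {a..b} f"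
    and ae: "AE r in lborel. r \<in> {a..b} \<longrightarrow>
      (\<exists>d\<le>c. (f has_real_derivative d) (at r within {a..b}))"
  shows "f b - f a \<le> c * (b - a)"
proof -
  define E where "E = {r \<in> {a..b}. \<not> (\<exists>d\<le>c. (f has_real_derivative d) (at r within {a..b}))}"
  obtain N where N: "N \<in> null_sets lborel" "E \<subseteq> N"
    using ae unfolding eventually_ae_filter E_def by (auto simp: subset_eq)
  then have "negligible N"
    by (simp add: negligible_iff_null_sets null_sets_completionI)
  then have "negligible E" using N(2) negligible_subset by blast
  show ?thesis
  proof (rule right_growth_le[where E = E])
    show "continuous_on {a..b} f" by (rule lipschitz_on_continuous_on[OF lip])
    show "negligible ((\<lambda>t. f t - m * t) ` E)" for m
    proof (rule negligible_locally_Lipschitz_image[OF _ \<open>negligible E\<close>])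
      fix r assume r: "r \<in> E"
      have "norm ((f y - m * y) - (f r - m * r)) \<le> (C + \<bar>m\<bar>) * norm (y - r)" if y: "y \<in> E" for y
      proof -
        have "\<bar>f y - f r\<bar> \<le> C * \<bar>y - r\<bar>"
          using lipschitz_onD[OF lip, of y r] y r by (simp add: E_def dist_real_def)
        moreover have "(f y - m * y) - (f r - m * r) = (f y - f r) - m * (y - r)"
          by (simp add: algebra_simps)
        moreover have "\<bar>m * (y - r)\<bar> = \<bar>m\<bar> * \<bar>y - r\<bar>" by (rule abs_mult)
        ultimately show ?thesis by (simp add: distrib_right)
      qed
      then show "\<exists>T B. open T \<and> r \<in> T \<and>
          (\<forall>y\<in>E \<inter> T. norm ((f y - m * y) - (f r - m * r)) \<le> B * norm (y - r))"
        by (intro exI[of _ UNIV] exI[of _ "C + \<bar>m\<bar>"]) simp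
    qed simp
    fix t e assume t: "a \<le> t" "t < b" "t \<notin> E" and e: "(0::real) < e"
    then obtain d where d: "d \<le> c" "(f has_real_derivative d) (at t within {a..b})"
      unfolding E_def by auto
    show "\<forall>\<^sub>F s in at_right t. f s - f t \<le> (c + e) * (s - t)"
      by (rule eventually_right_slope[OF d(2) t(2)]) (use t d e in auto)
  qed (rule ab)
qed

lemma V1_lipschitz: "V1 L v \<Longrightarrow> L-lipschitz_on {0..1} v"
  by (simp add: V1_def)

lemma V1_slope:
  assumes "V1 L v"
  obtains c where "c < 0" "AE r in lborel. r \<in> {0..1} \<longrightarrow>
       (\<exists>d\<le>c. (v has_real_derivative d) (at r within {0..1}))"
  using assms unfolding V1_def by (elim conjE exE) (rule that)

lemma V1_decreasing:
  assumes "V1 L v"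
  obtains c where "c < 0" "\<And>a b. 0 \<le> a \<Longrightarrow> a \<le> b \<Longrightarrow> b \<le> 1 \<Longrightarrow> v b - v a \<le> c * (b - a)"
proof -
  obtain c where c: "c < 0" and ae: "AE r in lborel. r \<in> {0..1} \<longrightarrow>
       (\<exists>d\<le>c. (v has_real_derivative d) (at r within {0..1}))"
    by (rule V1_slope[OF assms])
  have "v b - v a \<le> c * (b - a)" if "0 \<le> a" "a \<le> b" "b \<le> 1" for a b
  proof (rule lipschitz_AE_slope_le[OF that(2)])
    have sub: "{a..b} \<subseteq> {0..1}" using that by auto
    show "L-lipschitz_on {a..b} v"
      using V1_lipschitz[OF assms] sub by (rule lipschitz_on_subset)
    show "AE r in lborel. r \<in> {a..b} \<longrightarrow>
        (\<exists>d\<le>c. (v has_real_derivative d) (at r within {a..b}))"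
      using ae
    proof eventually_elim
      case (elim r)
      show ?case
      proof
        assume "r \<in> {a..b}"
        then obtain d where "d \<le> c" "(v has_real_derivative d) (at r within {0..1})"
          using elim sub by blast
        then show "\<exists>d\<le>c. (v has_real_derivative d) (at r within {a..b})"
          using DERIV_subset[OF _ sub] by blast
      qed
    qed
  qed
  with c that show thesis by blast
qed

lemma AE_scale:
  fixes \<mu> :: real
  assumes mu: "0 < \<mu>" and ae: "AE r in lborel. P r"
  shows "AE r in lborel. P (\<mu> * r)"
proof -
  obtain N where N: "N \<in> null_sets lborel" "{r \<in> space lborel. \<not> P r} \<subseteq> N"
    using ae unfolding eventually_ae_filter by blast
  let ?D = "distr lborel borel (\<lambda>r. 0 + \<mu> * r)"
  have "\<mu> \<noteq> 0" using mu by simp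
  from lborel_real_affine[OF this, of 0] AE_not_in[OF N(1)]
  have 1: "AE r in density ?D (\<lambda>_. ennreal \<bar>\<mu>\<bar>). r \<notin> N" by (rule subst)
  have 2: "(\<lambda>_. ennreal \<bar>\<mu>\<bar>) \<in> borel_measurable ?D" by (rule borel_measurable_const)
  have "AE r in ?D. 0 < ennreal \<bar>\<mu>\<bar> \<longrightarrow> r \<notin> N"
    using 1 unfolding AE_density[OF 2] .
  then have 3: "AE r in ?D. r \<notin> N" using mu by simp
  have 4: "{r \<in> space borel. r \<notin> N} \<in> sets borel"
  proof -
    have "N \<in> sets borel" using N(1) by auto
    then have "space borel - N \<in> sets borel" by blast
    then show ?thesis by (simp add: set_diff_eq)
  qed
  have 5: "(\<lambda>r. 0 + \<mu> * r) \<in> measurable lborel borel" by measurable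
  have "AE r in lborel. 0 + \<mu> * r \<notin> N" using 3 unfolding AE_distr_iff[OF 5 4] .
  then show ?thesis
  proof eventually_elim
    case (elim r)
    then have "\<mu> * r \<notin> {r \<in> space lborel. \<not> P r}"
      using contra_subsetD[OF N(2), of "\<mu> * r"] by (simp only: add_0_left not_False_eq_True)
    then show ?case by (simp only: mem_Collect_eq space_lborel space_borel UNIV_I simp_thms)
  qed
qed

text \<open>Condition (V2) says that \<open>v\<close> is concave as a function of the logarithm of the density:
  the derivative of \<open>s \<mapsto> v s - v (\<mu> * s)\<close> is \<open>(s * v' s - \<mu> * s * v' (\<mu> * s)) / s \<le> 0\<close> at almost
  every \<open>s\<close>.\<close>

lemma V2_scaling:
  assumes V1: "V1 L v" and V2: "V2 v"
    and ab: "0 < a" "a \<le> b" "b \<le> 1" and mu: "0 < \<mu>" "\<mu> \<le> 1"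
  shows "v (\<mu> * a) - v a \<le> v (\<mu> * b) - v b"
proof -
  let ?f = "\<lambda>s. v s - v (\<mu> * s)"
  have sub: "{a..b} \<subseteq> {0..1}" and mult_sub: "(\<lambda>s. \<mu> * s) ` {a..b} \<subseteq> {0..1}"
    using ab mu by (auto intro: mult_le_one)
  obtain c where ae: "AE r in lborel. r \<in> {0..1} \<longrightarrow>
       (\<exists>d\<le>c. (v has_real_derivative d) (at r within {0..1}))"
    by (rule V1_slope[OF V1])
  have ae_mult: "AE r in lborel. \<mu> * r \<in> {0..1} \<longrightarrow>
       (\<exists>d\<le>c. (v has_real_derivative d) (at (\<mu> * r) within {0..1}))"
    by (rule AE_scale[OF mu(1) ae])
  have "?f b - ?f a \<le> 0 * (b - a)"
  proof (rule lipschitz_AE_slope_le[OF ab(2)])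
    have lip: "L-lipschitz_on {0..1} v" by (rule V1_lipschitz[OF V1])
    show "(L + L * \<mu>)-lipschitz_on {a..b} ?f"
    proof (rule lipschitz_on_diff)
      show "L-lipschitz_on {a..b} v" using lip sub by (rule lipschitz_on_subset)
      have "\<mu>-lipschitz_on {a..b} (\<lambda>s. \<mu> * s)"
        by (rule lipschitz_onI) (use mu in \<open>auto simp: dist_real_def abs_mult right_diff_distrib[symmetric]\<close>)
      moreover have "L-lipschitz_on ((\<lambda>s. \<mu> * s) ` {a..b}) v"
        using lip mult_sub by (rule lipschitz_on_subset)
      ultimately show "(L * \<mu>)-lipschitz_on {a..b} (\<lambda>s. v (\<mu> * s))"
        by (rule lipschitz_on_compose2)
    qed
    show "AE r in lborel. r \<in> {a..b} \<longrightarrow>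
        (\<exists>d\<le>0. (?f has_real_derivative d) (at r within {a..b}))"
      using ae ae_mult
    proof eventually_elim
      case (elim r)
      show ?case
      proof
        assume r: "r \<in> {a..b}"
        then have r01: "r \<in> {0..1}" "\<mu> * r \<in> {0..1}" "0 < r" "\<mu> * r \<le> r"
          using subsetD[OF sub r] subsetD[OF mult_sub imageI[OF r]] ab mu
          by (auto simp: mult_le_cancel_right1)
        from elim(1) r01(1) obtain d where d: "(v has_real_derivative d) (at r within {0..1})"
          by (elim impE exE conjE)
        from elim(2) r01(2)
        obtain d' where d': "(v has_real_derivative d') (at (\<mu> * r) within {0..1})"
          by (elim impE exE conjE)
        have "r * d \<le> \<mu> * r * d'"
        proof (rule V2[unfolded V2_def, rule_format], intro conjI)
          show "0 \<le> \<mu> * r" "\<mu> * r \<le> r" "r \<le> 1" using r01 by auto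
        qed (fact d', fact d)
        then have "r * (d - d' * \<mu>) \<le> 0" by (simp add: algebra_simps)
        then have neg: "d - d' * \<mu> \<le> 0" using r01(3) by (simp add: mult_le_0_iff)
        have "(v has_real_derivative d) (at r within {a..b})"
          by (rule DERIV_subset[OF d sub])
        moreover have "((\<lambda>s. v (\<mu> * s)) has_real_derivative d' * \<mu>) (at r within {a..b})"
        proof (rule DERIV_image_chain[of v d' "\<lambda>s. \<mu> * s" r "{a..b}" \<mu>, unfolded o_def])
          show "(v has_real_derivative d') (at (\<mu> * r) within (\<lambda>s. \<mu> * s) ` {a..b})"
            by (rule DERIV_subset[OF d' mult_sub])
          show "((\<lambda>s. \<mu> * s) has_real_derivative \<mu>) (at r within {a..b})"
            by (auto intro!: derivative_eq_intros)
        qed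
        ultimately have "(?f has_real_derivative d - d' * \<mu>) (at r within {a..b})"
          by (rule DERIV_diff)
        with neg show "\<exists>d\<le>0. (?f has_real_derivative d) (at r within {a..b})"
          by (intro exI conjI)
      qed
    qed
  qed
  then show ?thesis by simp
qed

section \<open>A single solution\<close>

locale ftl =
  fixes v :: "real \<Rightarrow> real" and L :: real and N :: nat and x :: "nat \<Rightarrow> real \<Rightarrow> real"
  assumes V1: "V1 L v" and N_ge: "1 \<le> N" and sol: "ftl_solution v N x"
begin

definition gap :: "nat \<Rightarrow> real \<Rightarrow> real" where
  "gap j t = x (Suc j) t - x j t"

text \<open>The density is extended by \<open>0\<close> ahead of the leader, so that the leader, too, moves with the
  velocity \<open>v (cell N t) = v 0\<close>.\<close>

definition cell :: "nat \<Rightarrow> real \<Rightarrow> real" where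
  "cell j t = (if j < N then (1 / real N) / gap j t else 0)"

definition gap_rate :: "nat \<Rightarrow> real \<Rightarrow> real" where
  "gap_rate j t = v (cell (Suc j) t) - v (cell j t)"

definition variation :: "real \<Rightarrow> real" where
  "variation t = (\<Sum>j<N. \<bar>cell (Suc j) t - cell j t\<bar>)"

lemma N_pos: "0 < real N"
  using N_ge by simp

lemma gap_pos: "j < N \<Longrightarrow> 0 \<le> t \<Longrightarrow> 0 < gap j t"
  using sol[unfolded ftl_solution_def, THEN conjunct2, THEN conjunct1, rule_format, of t j]
  by (simp add: gap_def)

lemma cell_bounds:
  assumes "0 \<le> t" shows "0 \<le> cell j t" "cell j t \<le> 1"
proof -
  have "(1 / real N) / (x (Suc j) t - x j t) \<in> {0..1}" if "j < N"
    using sol[unfolded ftl_solution_def, THEN conjunct2, THEN conjunct1, rule_format, of t j]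
      assms that by simp
  then show "0 \<le> cell j t" "cell j t \<le> 1"
    by (auto simp: cell_def gap_def)
qed

lemma cell_pos: "j < N \<Longrightarrow> 0 \<le> t \<Longrightarrow> 0 < cell j t"
  using gap_pos N_pos by (simp add: cell_def)

lemma cell_beyond: "N \<le> j \<Longrightarrow> cell j t = 0"
  by (simp add: cell_def)

lemma cell_gap: "j < N \<Longrightarrow> 0 \<le> t \<Longrightarrow> cell j t * gap j t = 1 / real N"
  using gap_pos[of j t] by (simp add: cell_def)

lemma v_mono: "0 \<le> a \<Longrightarrow> a \<le> b \<Longrightarrow> b \<le> 1 \<Longrightarrow> v b \<le> v a"
proof -
  assume ab: "0 \<le> a" "a \<le> b" "b \<le> 1"
  obtain c where c: "c < 0" "\<And>a b. 0 \<le> a \<Longrightarrow> a \<le> b \<Longrightarrow> b \<le> 1 \<Longrightarrow> v b - v a \<le> c * (b - a)"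
    by (rule V1_decreasing[OF V1]) blast
  have "c * (b - a) \<le> 0" using c(1) ab by (simp add: mult_nonpos_nonneg)
  then show ?thesis using c(2)[OF ab] by linarith
qed

lemma v_cell_bounds: assumes "0 \<le> t" shows "0 \<le> v (cell j t)" "v (cell j t) \<le> v 0"
  using v_mono[of "cell j t" 1] v_mono[of 0 "cell j t"] cell_bounds[OF assms, of j] V1
  by (auto simp: V1_def)

lemma v_0_nonneg: "0 \<le> v 0"
  using v_cell_bounds[of 0 0] by simp

lemma v_lipschitz: "a \<in> {0..1} \<Longrightarrow> b \<in> {0..1} \<Longrightarrow> \<bar>v a - v b\<bar> \<le> L * \<bar>a - b\<bar>"
  using lipschitz_onD[OF V1_lipschitz[OF V1], of a b] by (simp add: dist_real_def)

lemma L_nonneg: "0 \<le> L"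
  using V1_lipschitz[OF V1] by (rule lipschitz_on_nonneg)

lemma deriv_position:
  assumes "j \<le> N" "0 \<le> t"
  shows "(x j has_real_derivative v (cell j t)) (at t within {0..})"
proof (cases "j < N")
  case True
  from sol[unfolded ftl_solution_def, THEN conjunct2, THEN conjunct2, THEN conjunct2,
      rule_format, OF assms(2) this]
  show ?thesis using True by (simp add: cell_def gap_def)
next
  case False
  then have "j = N" using assms by simp
  from sol[unfolded ftl_solution_def, THEN conjunct2, THEN conjunct2, THEN conjunct1,
      rule_format, OF assms(2)]
  show ?thesis using \<open>j = N\<close> by (simp add: cell_def)
qed

lemma deriv_gap:
  assumes "j < N" "0 \<le> t"
  shows "(gap j has_real_derivative gap_rate j t) (at t within {0..})"
proof -
  have "((\<lambda>t. x (Suc j) t - x j t) has_real_derivative v (cell (Suc j) t) - v (cell j t))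
      (at t within {0..})"
    by (rule DERIV_diff; rule deriv_position) (use assms in auto)
  then show ?thesis by (simp add: gap_def[abs_def] gap_rate_def)
qed

lemma deriv_cell:
  assumes "0 \<le> t"
  shows "(cell j has_real_derivative - real N * (cell j t)\<^sup>2 * gap_rate j t) (at t within {0..})"
proof (cases "j < N")
  case True
  have gap: "gap j t \<noteq> 0" using gap_pos[OF True assms] by simp
  have "((\<lambda>t. (1 / real N) / gap j t) has_real_derivative
      (0 * gap j t - (1 / real N) * gap_rate j t) / (gap j t * gap j t)) (at t within {0..})"
    by (rule DERIV_divide[OF DERIV_const deriv_gap[OF True assms] gap])
  moreover have "(0 * gap j t - (1 / real N) * gap_rate j t) / (gap j t * gap j t)
      = - real N * (cell j t)\<^sup>2 * gap_rate j t"
    using True gap N_pos by (simp add: cell_def field_simps power2_eq_square)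
  moreover have "cell j = (\<lambda>t. (1 / real N) / gap j t)"
    using True by (simp add: cell_def[abs_def])
  ultimately show ?thesis by simp
next
  case False
  then have "cell j = (\<lambda>t. 0)" by (simp add: cell_def[abs_def])
  then show ?thesis by simp
qed

lemma continuous_gap: "j < N \<Longrightarrow> continuous_on {0..} (gap j)"
  by (rule DERIV_continuous_on[of _ _ "gap_rate j"]) (rule deriv_gap, auto)

lemma continuous_v_cell: "continuous_on {0..} (\<lambda>t. v (cell j t))"
proof (rule continuous_on_compose2[of "{0..1}" v])
  show "continuous_on {0..1} v"
    by (rule lipschitz_on_continuous_on[OF V1_lipschitz[OF V1]])
  show "continuous_on {0..} (cell j)"
    by (rule DERIV_continuous_on) (rule deriv_cell, simp)
  show "cell j ` {0..} \<subseteq> {0..1}" using cell_bounds by auto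
qed

lemma position_less: "0 \<le> t \<Longrightarrow> i < j \<Longrightarrow> j \<le> N \<Longrightarrow> x i t < x j t"
proof (induction j)
  case (Suc j)
  have "x j t < x (Suc j) t" using gap_pos[of j t] Suc.prems by (simp add: gap_def)
  then show ?case using Suc by (cases "i = j") auto
qed simp

lemma position_le: "0 \<le> t \<Longrightarrow> i \<le> j \<Longrightarrow> j \<le> N \<Longrightarrow> x i t \<le> x j t"
  using position_less[of t i j] by (cases "i = j") auto

lemma span_growth: 
  assumes "0 \<le> t" shows "x N t - x 0 t \<le> x N 0 - x 0 0 + v 0 * t"
proof -
  have "(x N t - x 0 t) - (x N 0 - x 0 0) \<le> v 0 * (t - 0)"
  proof (rule growth_le_of_deriv[where d = "\<lambda>s. v (cell N s) - v (cell 0 s)"])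
    fix s :: real assume "0 \<le> s"
    then show "((\<lambda>s. x N s - x 0 s) has_real_derivative v (cell N s) - v (cell 0 s))
        (at s within {0..})"
      by (intro DERIV_diff deriv_position) auto
  next
    fix s assume "0 \<le> s" "s < t"
    then show "v (cell N s) - v (cell 0 s) \<le> v 0"
      using v_cell_bounds(1)[of s 0] v_cell_bounds(2)[of s N] by linarith
  qed (use assms in auto)
  then show ?thesis by simp
qed

subsection \<open>Decay of the variation\<close>

text \<open>The increment \<open>cell (Suc j) - cell j\<close> changes at the rate \<open>cell' (Suc j) - cell' j\<close>. Where the
  density increases forward, the vehicle behind is the faster one because \<open>v\<close> decreases, so its
  cell gets denser: the flux \<open>cell' j\<close> has the sign of the increment.\<close>

lemma variation_decreasing:
  assumes "0 \<le> t" shows "variation t \<le> variation 0"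
proof -
  define e where "e = (\<lambda>j t. - real N * (cell j t)\<^sup>2 * gap_rate j t)"
  show ?thesis unfolding variation_def
  proof (rule sum_abs_flux_nonincreasing[where e = e])
    fix j t assume j: "j < N" and t: "(0::real) \<le> t"
    show "((\<lambda>t. cell (Suc j) t - cell j t) has_real_derivative e (Suc j) t - e j t)
        (at t within {0..})"
      unfolding e_def by (intro DERIV_diff deriv_cell t)
    have mono: "cell i t \<le> cell k t \<Longrightarrow> v (cell k t) \<le> v (cell i t)" for i k
      using v_mono[of "cell i t" "cell k t"] cell_bounds[OF t] by simp
    have N2: "0 \<le> real N * (cell j t)\<^sup>2" by simp
    consider "cell (Suc j) t = cell j t" | "cell j t < cell (Suc j) t" | "cell (Suc j) t < cell j t"
      by linarith
    then show "e j t = \<bar>e j t\<bar> * sgn (cell (Suc j) t - cell j t)"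
    proof cases
      case 1
      then show ?thesis by (simp add: e_def gap_rate_def)
    next
      case 2
      then have "gap_rate j t \<le> 0" using mono[of j "Suc j"] by (simp add: gap_rate_def)
      then have "0 \<le> e j t" using mult_nonneg_nonpos[OF N2] by (simp add: e_def)
      then show ?thesis using 2 by simp
    next
      case 3
      then have "0 \<le> gap_rate j t" using mono[of "Suc j" j] by (simp add: gap_rate_def)
      then have "e j t \<le> 0" using mult_nonneg_nonneg[OF N2] by (simp add: e_def)
      then show ?thesis using 3 by simp
    qed
  next
    show "e N t = 0" for t by (simp add: e_def cell_beyond)
  qed (use assms in auto)
qed

lemma density_at_position:
  assumes "0 \<le> t" "j \<le> N" shows "eulerian_density N x t (x j t) = cell j t"
proof -
  have "eulerian_density N x t (x j t) = (\<Sum>i<N. if i = j then cell j t else 0)"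
    unfolding eulerian_density_def
  proof (rule sum.cong)
    fix i assume i: "i \<in> {..<N}"
    consider "i < j" | "i = j" | "j < i" by linarith
    then show "1 / real N / (x (Suc i) t - x i t) * indicator {x i t..<x (Suc i) t} (x j t) =
        (if i = j then cell j t else 0)"
    proof cases
      case 1
      then show ?thesis using position_le[of t "Suc i" j] assms by (simp add: indicator_def)
    next
      case 2
      then show ?thesis using gap_pos[of j t] assms i by (simp add: cell_def gap_def)
    next
      case 3
      then show ?thesis using position_less[of t j i] assms i by (simp add: indicator_def)
    qed
  qed simp
  also have "\<dots> = cell j t" by (simp add: cell_def)
  finally show ?thesis .
qed

lemma variation_le_TV:
  assumes "0 \<le> t" shows "ennreal (variation t) \<le> TV (eulerian_density N x t)"
proof -
  let ?f = "eulerian_density N x t" and ?p = "\<lambda>i. x (min i N) t"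
  have "mono ?p" by (rule monoI) (use position_le assms in \<open>simp add: min_le_iff_disj\<close>)
  then have "(\<Sum>i<N. ennreal \<bar>?f (?p (Suc i)) - ?f (?p i)\<bar>) \<le> TV ?f"
    unfolding TV_def by (intro SUP_upper2[of "(N, ?p)"]) auto
  moreover have "(\<Sum>i<N. ennreal \<bar>?f (?p (Suc i)) - ?f (?p i)\<bar>) = ennreal (variation t)"
    unfolding variation_def using assms by (subst sum_ennreal[symmetric])
      (auto intro!: sum.cong simp: density_at_position)
  ultimately show ?thesis by simp
qed

subsection \<open>Smoothing\<close>

lemma deriv_scaled_cell:
  assumes "j < N" "0 \<le> t"
  shows "((\<lambda>t. t * cell j t) has_real_derivative
      real N * (cell j t)\<^sup>2 * (gap j t - t * gap_rate j t)) (at t within {0..})"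
proof -
  have "((\<lambda>t. t * cell j t) has_real_derivative
      1 * cell j t + - real N * (cell j t)\<^sup>2 * gap_rate j t * t) (at t within {0..})"
    by (rule DERIV_mult[OF DERIV_ident deriv_cell[OF assms(2)]])
  moreover have "cell j t = real N * (cell j t)\<^sup>2 * gap j t"
    using cell_gap[OF assms] N_pos by (simp add: power2_eq_square)
  ultimately show ?thesis by (simp add: algebra_simps)
qed

lemma scaled_cell_nondecreasing:
  assumes "j < N" "0 \<le> a" "a \<le> b"
    and "\<And>t. a \<le> t \<Longrightarrow> t < b \<Longrightarrow> t * gap_rate j t \<le> gap j t"
  shows "a * cell j a \<le> b * cell j b"
proof -
  have "- (b * cell j b) - - (a * cell j a) \<le> 0 * (b - a)"
  proof (rule growth_le_of_deriv)
    fix t :: real assume "0 \<le> t"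
    then show "((\<lambda>t. - (t * cell j t)) has_real_derivative
        - (real N * (cell j t)\<^sup>2 * (gap j t - t * gap_rate j t))) (at t within {0..})"
      by (intro DERIV_minus deriv_scaled_cell assms)
  next
    fix t assume "a \<le> t" "t < b"
    then show "- (real N * (cell j t)\<^sup>2 * (gap j t - t * gap_rate j t)) \<le> 0"
      using assms by simp
  qed (use assms in auto)
  then show ?thesis by simp
qed

lemma scaled_cell_nonincreasing:
  assumes "j < N" "0 \<le> a" "a \<le> b"
    and "\<And>t. a \<le> t \<Longrightarrow> t < b \<Longrightarrow> gap j t \<le> t * gap_rate j t"
  shows "b * cell j b \<le> a * cell j a"
proof -
  have "b * cell j b - a * cell j a \<le> 0 * (b - a)"
  proof (rule growth_le_of_deriv)
    fix t :: real assume "0 \<le> t"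
    then show "((\<lambda>t. t * cell j t) has_real_derivative
        real N * (cell j t)\<^sup>2 * (gap j t - t * gap_rate j t)) (at t within {0..})"
      by (intro deriv_scaled_cell assms)
  next
    fix t assume "a \<le> t" "t < b"
    then show "real N * (cell j t)\<^sup>2 * (gap j t - t * gap_rate j t) \<le> 0"
      using assms by (intro mult_nonneg_nonpos) auto
  qed (use assms in auto)
  then show ?thesis by simp
qed

lemma v_cell_less_imp:
  assumes "0 \<le> t" "v (cell j t) < v (cell i t)" shows "cell i t < cell j t"
  using v_mono[of "cell j t" "cell i t"] cell_bounds[OF assms(1)] assms(2) by force

text \<open>Suppose that the bound on \<open>gap_rate\<close> fails at time \<open>b\<close> and let \<open>a\<close> be the last time before at
  which it was an equality. In between \<open>t * cell j t\<close> does not increase, whereas \<open>t * cell (Suc j) t\<close>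
  does not decrease. Comparing \<open>v\<close> at the densities rescaled by \<open>a / b\<close>, condition (V2) gives
  \<open>gap_rate j b \<le> gap_rate j a = gap j a / a \<le> gap j b / b\<close>, a contradiction.\<close>

lemma gap_rate_le_step:
  assumes V2: "V2 v" and j: "j < N" and b: "0 \<le> b"
    and ahead: "\<And>s t. 0 \<le> s \<Longrightarrow> s \<le> t \<Longrightarrow> s * cell (Suc j) s \<le> t * cell (Suc j) t"
  shows "b * gap_rate j b \<le> gap j b"
proof (rule ccontr)
  define z where "z = (\<lambda>t. t * gap_rate j t - gap j t)"
  assume "\<not> ?thesis"
  then have zb: "0 < z b" by (simp add: z_def)
  have "continuous_on {0..} z"
    unfolding z_def gap_rate_def
    by (intro continuous_intros continuous_v_cell continuous_gap[OF j])
  then have cont: "continuous_on {0..b} z" by (rule continuous_on_subset) auto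
  have z0: "z 0 < 0" using gap_pos[OF j, of 0] by (simp add: z_def)
  obtain a where a: "0 \<le> a" "a < b" "z a = 0" and above: "\<And>t. a < t \<Longrightarrow> t \<le> b \<Longrightarrow> 0 < z t"
    by (rule last_crossing[OF cont b, of 0]) (use z0 zb in auto)
  have "a \<noteq> 0" using a z0 by auto
  then have a_pos: "0 < a" "0 < b" using a by auto
  have "gap j t \<le> t * gap_rate j t" if "a \<le> t" "t < b" for t
    using above[of t] a(3) that by (cases "t = a") (auto simp: z_def)
  then have behind: "b * cell j b \<le> a * cell j a"
    by (intro scaled_cell_nonincreasing j) (use a in auto)
  define p q \<mu> where "p = cell (Suc j) a" and "q = cell j a" and "\<mu> = a / b"
  have mu: "0 < \<mu>" "\<mu> \<le> 1" using a a_pos by (auto simp: \<mu>_def)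
  have bnd: "0 \<le> p" "0 \<le> q" "q \<le> 1" "p \<le> 1" using cell_bounds a by (auto simp: p_def q_def)
  have rate_a: "a * gap_rate j a = gap j a" using a(3) by (simp add: z_def)
  then have "0 < a * gap_rate j a" using gap_pos[OF j a(1)] by simp
  then have "0 < gap_rate j a" using a_pos by (simp add: zero_less_mult_iff)
  then have "p < q"
    using v_cell_less_imp[OF a(1), of j "Suc j"] by (simp add: gap_rate_def p_def q_def)
  have "cell j b \<le> \<mu> * q" using behind a_pos by (simp add: \<mu>_def q_def field_simps)
  then have "v (\<mu> * q) \<le> v (cell j b)"
    using cell_bounds(1)[of b j] bnd mu a_pos by (intro v_mono) (auto intro: mult_le_one)
  moreover have "\<mu> * p \<le> cell (Suc j) b"
    using ahead[of a b] a a_pos by (simp add: \<mu>_def p_def field_simps)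
  then have "v (cell (Suc j) b) \<le> v (\<mu> * p)"
    using cell_bounds(2)[of b "Suc j"] bnd mu a_pos by (intro v_mono) auto
  moreover have "v (\<mu> * p) - v (\<mu> * q) \<le> v p - v q"
  proof (cases "p = 0")
    case True
    have "\<mu> * q \<le> q" using bnd mu by (simp add: mult_left_le_one_le)
    then have "v q \<le> v (\<mu> * q)" using bnd mu by (intro v_mono) auto
    then show ?thesis using True by simp
  next
    case False
    then show ?thesis
      using V2_scaling[OF V1 V2, of p q \<mu>] \<open>p < q\<close> bnd mu by simp
  qed
  ultimately have "gap_rate j b \<le> gap_rate j a"
    by (simp add: gap_rate_def p_def q_def)
  then have "b * gap_rate j b \<le> b * gap_rate j a" using a_pos by simp
  also have "\<dots> = b * gap j a / a" using rate_a a_pos by (simp add: field_simps)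
  also have "\<dots> \<le> gap j b"
  proof -
    have "b * (1 / real N / gap j b) \<le> a * (1 / real N / gap j a)"
      using behind j by (simp add: cell_def)
    then show ?thesis
      using gap_pos[OF j, of a] gap_pos[OF j, of b] a_pos N_pos by (simp add: field_simps)
  qed
  finally show False using zb by (simp add: z_def)
qed

text \<open>This is the discrete counterpart of the Oleinik estimate. The induction runs from the leader
  backwards, because every vehicle reacts only to the one ahead.\<close>

lemma gap_rate_le:
  assumes V2: "V2 v" and j: "j < N" and t: "0 \<le> t"
  shows "t * gap_rate j t \<le> gap j t"
proof -
  have "\<forall>s t. 0 \<le> s \<and> s \<le> t \<longrightarrow> s * cell j s \<le> t * cell j t" if "j \<le> N" for j
    using that
  proof (induction rule: inc_induct)
    case base
    then show ?case by (simp add: cell_beyond)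
  next
    case (step i)
    show ?case
    proof (intro allI impI, elim conjE)
      fix s t :: real assume "0 \<le> s" "s \<le> t"
      then show "s * cell i s \<le> t * cell i t"
      proof (intro scaled_cell_nondecreasing[OF step(2)])
        fix r assume "s \<le> r" "r < t"
        then have "0 \<le> r" using \<open>0 \<le> s\<close> by simp
        then show "r * gap_rate i r \<le> gap i r"
          using step.IH by (intro gap_rate_le_step[OF V2 step(2)]) blast+
      qed
    qed
  qed
  from this[of "Suc j"] j show ?thesis
    by (intro gap_rate_le_step[OF V2 j t]) (simp add: Suc_leI)
qed

text \<open>The increments of \<open>v\<close> over the cells add up to at most \<open>v 0\<close> in absolute value, so a bound for
  their positive parts, here \<open>gap j t / t\<close>, bounds the total variation. The bound on the slope of
  \<open>v\<close> transfers this to the density itself.\<close>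

lemma variation_smoothing:
  assumes V2: "V2 v" and t: "0 < t"
    and c: "\<And>a b. 0 \<le> a \<Longrightarrow> a \<le> b \<Longrightarrow> b \<le> 1 \<Longrightarrow> v b - v a \<le> - c * (b - a)"
  shows "c * variation t \<le> 2 * ((x N 0 - x 0 0) / t + v 0)"
proof -
  have t0: "0 \<le> t" using t by simp
  have "c * variation t \<le> (\<Sum>j<N. 2 * (gap j t / t) - gap_rate j t)"
    unfolding variation_def sum_distrib_left
  proof (rule sum_mono)
    fix j assume "j \<in> {..<N}"
    then have j: "j < N" by simp
    have "gap_rate j t \<le> gap j t / t"
      using gap_rate_le[OF V2 j t0] t by (simp add: field_simps)
    moreover have "0 \<le> gap j t / t" using gap_pos[OF j t0] t by simp
    moreover have "c * \<bar>cell (Suc j) t - cell j t\<bar> \<le> \<bar>gap_rate j t\<bar>"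
    proof (cases "cell j t \<le> cell (Suc j) t")
      case True
      then show ?thesis
        using c[of "cell j t" "cell (Suc j) t"] cell_bounds[OF t0] by (simp add: gap_rate_def)
    next
      case False
      then show ?thesis
        using c[of "cell (Suc j) t" "cell j t"] cell_bounds[OF t0]
        by (simp add: gap_rate_def algebra_simps)
    qed
    ultimately show "c * \<bar>cell (Suc j) t - cell j t\<bar> \<le> 2 * (gap j t / t) - gap_rate j t"
      by linarith
  qed
  also have "\<dots> = 2 * ((x N t - x 0 t) / t) - (v (cell N t) - v (cell 0 t))"
  proof -
    have "(\<Sum>j<N. gap j t) = x N t - x 0 t"
      unfolding gap_def by (rule sum_lessThan_telescope)
    moreover have "(\<Sum>j<N. gap_rate j t) = v (cell N t) - v (cell 0 t)"
      unfolding gap_rate_def by (rule sum_lessThan_telescope)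
    ultimately show ?thesis
      by (simp add: sum_subtractf sum_distrib_left[symmetric] sum_divide_distrib[symmetric])
  qed
  also have "\<dots> \<le> 2 * ((x N t - x 0 t) / t)"
    using v_cell_bounds(2)[OF t0, of 0] by (simp add: cell_beyond)
  also have "\<dots> \<le> 2 * ((x N 0 - x 0 0 + v 0 * t) / t)"
    using span_growth[OF t0] t by (intro mult_left_mono divide_right_mono) auto
  also have "\<dots> = 2 * ((x N 0 - x 0 0) / t + v 0)"
    using t by (simp add: add_divide_distrib)
  finally show ?thesis .
qed

end

section \<open>Two solutions\<close>

lemma (in ftl) leader_position:
  assumes "0 \<le> t" shows "x N t = x N 0 + v 0 * t"
proof -
  have der: "(x N has_real_derivative v 0) (at s within {0..})" if "0 \<le> s" for s
    using deriv_position[OF order_refl that] by (simp add: cell_beyond)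
  have "x N t - x N 0 \<le> v 0 * (t - 0)"
    by (rule growth_le_of_deriv[OF der]) (use assms in auto)
  moreover have "- x N t - - x N 0 \<le> - v 0 * (t - 0)"
    by (rule growth_le_of_deriv[OF DERIV_minus[OF der]]) (use assms in auto)
  ultimately show ?thesis by simp
qed

lemma (in ftl) gap_ge: "j < N \<Longrightarrow> 0 \<le> t \<Longrightarrow> 1 / real N \<le> gap j t"
  using cell_bounds(2)[of t j] gap_pos[of j t] by (simp add: cell_def field_simps)

lemma (in ftl) density_cells:
  "eulerian_density N x t y = (\<Sum>j<N. cell j t * indicator {x j t..<x (Suc j) t} y)"
  unfolding eulerian_density_def by (rule sum.cong) (auto simp: cell_def gap_def)

lemma (in ftl) position_eq_leader_minus_gaps:
  "j \<le> N \<Longrightarrow> x j t = x N t - (\<Sum>i=j..<N. gap i t)"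
  using sum_Suc_diff'[of j N "\<lambda>i. x i t"] by (simp add: gap_def)

locale ftl_pair = ftl v L N x + other: ftl v L N x'
  for v :: "real \<Rightarrow> real" and L :: real and N :: nat and x x' :: "nat \<Rightarrow> real \<Rightarrow> real"
begin

definition gap_dist :: "real \<Rightarrow> real" where
  "gap_dist t = (\<Sum>j<N. \<bar>gap j t - other.gap j t\<bar>)"

definition shift :: "nat \<Rightarrow> real \<Rightarrow> real" where
  "shift j t = (x j t - x' j t) - (x j 0 - x' j 0)"

lemma gap_dist_0: "gap_dist 0 = gap_diff N x x'"
  by (simp add: gap_dist_def gap_diff_def gap_def other.gap_def)

lemma gap_dist_nonneg: "0 \<le> gap_dist t"
  by (simp add: gap_dist_def sum_nonneg)

subsection \<open>Contraction and drift\<close>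

text \<open>The gaps form a system in flux form with flux \<open>v (cell j t)\<close>, which increases with the gap
  because \<open>v\<close> decreases with the density; so the flux difference of the two solutions has the sign
  of the gap difference.\<close>

lemma gap_dist_contraction:
  assumes "0 \<le> t" shows "gap_dist t \<le> gap_dist 0"
proof -
  define e where "e = (\<lambda>j t. v (cell j t) - v (other.cell j t))"
  show ?thesis unfolding gap_dist_def
  proof (rule sum_abs_flux_nonincreasing[where e = e])
    fix j t assume j: "j < N" and t: "(0::real) \<le> t"
    have "((\<lambda>t. gap j t - other.gap j t) has_real_derivative gap_rate j t - other.gap_rate j t)
        (at t within {0..})"
      by (intro DERIV_diff deriv_gap other.deriv_gap j t)
    then show "((\<lambda>t. gap j t - other.gap j t) has_real_derivative e (Suc j) t - e j t)
        (at t within {0..})"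
      by (simp add: e_def gap_rate_def other.gap_rate_def algebra_simps)
    have pos: "0 < gap j t" "0 < other.gap j t"
      using gap_pos[OF j t] other.gap_pos[OF j t] by auto
    consider "gap j t = other.gap j t" | "gap j t < other.gap j t" | "other.gap j t < gap j t"
      by linarith
    then show "e j t = \<bar>e j t\<bar> * sgn (gap j t - other.gap j t)"
    proof cases
      case 1
      then show ?thesis by (simp add: e_def cell_def other.cell_def)
    next
      case 2
      then have "other.cell j t \<le> cell j t"
        using pos N_pos j by (simp add: cell_def other.cell_def frac_le)
      then have "e j t \<le> 0"
        using v_mono cell_bounds[OF t] other.cell_bounds[OF t] by (simp add: e_def)
      then show ?thesis using 2 by simp
    next
      case 3
      then have "cell j t \<le> other.cell j t"
        using pos N_pos j by (simp add: cell_def other.cell_def frac_le)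
      then have "0 \<le> e j t"
        using v_mono cell_bounds[OF t] other.cell_bounds[OF t] by (simp add: e_def)
      then show ?thesis using 3 by simp
    qed
  next
    show "e N t = 0" for t by (simp add: e_def cell_beyond other.cell_beyond)
  qed (use assms in auto)
qed

text \<open>Corresponding cells carry the same mass \<open>1 / N\<close>, so the differences of densities and of gaps
  are proportional with factors \<open>cell j t \<le> 1\<close> and \<open>other.gap j t \<ge> 1 / N\<close>.\<close>

lemma cell_diff:
  assumes j: "j < N" and t: "0 \<le> t"
  shows "\<bar>cell j t - other.cell j t\<bar> * other.gap j t \<le> \<bar>gap j t - other.gap j t\<bar>"
    and "\<bar>cell j t - other.cell j t\<bar> \<le> real N * \<bar>gap j t - other.gap j t\<bar>"
proof -
  have pos: "0 < gap j t" "0 < other.gap j t"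
    using gap_pos[OF j t] other.gap_pos[OF j t] by auto
  have "cell j t * (gap j t - other.gap j t) = (other.cell j t - cell j t) * other.gap j t"
    using cell_gap[OF j t] other.cell_gap[OF j t] by (simp add: algebra_simps)
  then have "\<bar>cell j t * (gap j t - other.gap j t)\<bar>
      = \<bar>(other.cell j t - cell j t) * other.gap j t\<bar>" by simp
  then have eq: "\<bar>cell j t - other.cell j t\<bar> * other.gap j t
      = cell j t * \<bar>gap j t - other.gap j t\<bar>"
    using pos cell_bounds(1)[OF t, of j] by (simp add: abs_mult abs_minus_commute)
  then show first: "\<bar>cell j t - other.cell j t\<bar> * other.gap j t \<le> \<bar>gap j t - other.gap j t\<bar>"
    using cell_bounds[OF t, of j] by (simp add: mult_left_le_one_le)
  have "\<bar>cell j t - other.cell j t\<bar> * (1 / real N) \<le> \<bar>cell j t - other.cell j t\<bar> * other.gap j t"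
    using other.gap_ge[OF j t] by (rule mult_left_mono) simp
  from order_trans[OF this first]
  show "\<bar>cell j t - other.cell j t\<bar> \<le> real N * \<bar>gap j t - other.gap j t\<bar>"
    using N_pos by (simp add: field_simps)
qed

lemma sum_shift_le:
  assumes t: "0 \<le> t"
  shows "(\<Sum>j<N. \<bar>shift j t\<bar>) \<le> real N * (L * t * gap_dist 0)"
proof -
  define d where "d = (\<lambda>j t. v (cell j t) - v (other.cell j t))"
  have "(\<Sum>j<N. \<bar>shift j t\<bar>) \<le> (\<Sum>j<N. \<bar>shift j 0\<bar>) + (real N * L * gap_dist 0) * (t - 0)"
  proof (rule sum_abs_growth[where d = d])
    fix j s assume j: "j < N" and s: "(0::real) \<le> s"
    have "((\<lambda>t. (x j t - x' j t) - (x j 0 - x' j 0)) has_real_derivative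
        (v (cell j s) - v (other.cell j s)) - 0) (at s within {0..})"
      using j s
      by (intro DERIV_diff[OF DERIV_diff[OF deriv_position other.deriv_position] DERIV_const]) simp_all
    then show "(shift j has_real_derivative d j s) (at s within {0..})"
      unfolding shift_def[abs_def] d_def diff_zero .
  next
    fix s assume s: "(0::real) \<le> s" "s < t"
    have "(\<Sum>j<N. abs_slope (shift j s) (d j s)) \<le>
        (\<Sum>j<N. L * (real N * \<bar>gap j s - other.gap j s\<bar>))"
    proof (rule sum_mono)
      fix j assume "j \<in> {..<N}"
      then have j: "j < N" by simp
      have "abs_slope (shift j s) (d j s) \<le> \<bar>d j s\<bar>" by (rule abs_slope_le)
      also have "\<dots> \<le> L * \<bar>cell j s - other.cell j s\<bar>"
        unfolding d_def using cell_bounds[OF s(1)] other.cell_bounds[OF s(1)]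
        by (intro v_lipschitz) auto
      also have "\<dots> \<le> L * (real N * \<bar>gap j s - other.gap j s\<bar>)"
        by (rule mult_left_mono[OF cell_diff(2)[OF j s(1)] L_nonneg])
      finally show "abs_slope (shift j s) (d j s) \<le> L * (real N * \<bar>gap j s - other.gap j s\<bar>)" .
    qed
    also have "\<dots> = real N * L * gap_dist s"
      by (simp add: gap_dist_def sum_distrib_left mult_ac)
    also have "\<dots> \<le> real N * L * gap_dist 0"
      using gap_dist_contraction[OF s(1)] L_nonneg by (intro mult_left_mono) auto
    finally show "(\<Sum>j<N. abs_slope (shift j s) (d j s)) \<le> real N * L * gap_dist 0" .
  qed (use t in auto)
  also have "(\<Sum>j<N. \<bar>shift j 0\<bar>) = 0" by (simp add: shift_def)
  finally show ?thesis by (simp add: mult_ac)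
qed

lemma shift_leader: assumes "0 \<le> t" shows "shift N t = 0"
  unfolding shift_def
  unfolding leader_position[OF assms] other.leader_position[OF assms] by simp

lemma position_dist:
  assumes leader: "x N 0 = x' N 0" and j: "j \<le> N" and t: "0 \<le> t"
  shows "\<bar>x j t - x' j t\<bar> \<le> gap_dist 0"
proof -
  have "x N t = x' N t"
    using leader_position[OF t] other.leader_position[OF t] leader by simp
  then have "x j t - x' j t = - (\<Sum>i=j..<N. gap i t - other.gap i t)"
    using position_eq_leader_minus_gaps[OF j, of t] other.position_eq_leader_minus_gaps[OF j, of t]
    by (simp add: sum_subtractf)
  then have "\<bar>x j t - x' j t\<bar> = \<bar>\<Sum>i=j..<N. gap i t - other.gap i t\<bar>" by simp
  also have "\<dots> \<le> (\<Sum>i=j..<N. \<bar>gap i t - other.gap i t\<bar>)" by (rule sum_abs)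
  also have "\<dots> \<le> gap_dist t" unfolding gap_dist_def by (rule sum_mono2) auto
  also have "\<dots> \<le> gap_dist 0" by (rule gap_dist_contraction[OF t])
  finally show ?thesis .
qed

end

section \<open>The \<open>L\<^sup>1\<close> distance of the densities\<close>

lemma nn_integral_abs_le_sum:
  fixes f :: "'a \<Rightarrow> real" and h :: "'b \<Rightarrow> 'a \<Rightarrow> real"
  assumes meas: "\<And>i. i \<in> I \<Longrightarrow> h i \<in> borel_measurable M"
    and w: "\<And>i. i \<in> I \<Longrightarrow> 0 \<le> w i" and h: "\<And>i y. i \<in> I \<Longrightarrow> 0 \<le> h i y"
    and int: "\<And>i. i \<in> I \<Longrightarrow> (\<integral>\<^sup>+y. ennreal (h i y) \<partial>M) = ennreal (m i)"
    and m: "\<And>i. i \<in> I \<Longrightarrow> 0 \<le> m i"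
    and le: "\<And>y. \<bar>f y\<bar> \<le> (\<Sum>i\<in>I. w i * h i y)"
  shows "(\<integral>\<^sup>+y. ennreal \<bar>f y\<bar> \<partial>M) \<le> ennreal (\<Sum>i\<in>I. w i * m i)"
proof -
  have "(\<integral>\<^sup>+y. ennreal \<bar>f y\<bar> \<partial>M) \<le> (\<integral>\<^sup>+y. (\<Sum>i\<in>I. ennreal (w i) * ennreal (h i y)) \<partial>M)"
  proof (rule nn_integral_mono)
    fix y
    have "ennreal \<bar>f y\<bar> \<le> ennreal (\<Sum>i\<in>I. w i * h i y)" by (rule ennreal_leI[OF le])
    also have "\<dots> = (\<Sum>i\<in>I. ennreal (w i * h i y))"
      using w h by (intro sum_ennreal[symmetric]) auto
    also have "\<dots> = (\<Sum>i\<in>I. ennreal (w i) * ennreal (h i y))"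
      using w h by (intro sum.cong) (auto simp: ennreal_mult)
    finally show "ennreal \<bar>f y\<bar> \<le> (\<Sum>i\<in>I. ennreal (w i) * ennreal (h i y))" .
  qed
  also have "\<dots> = (\<Sum>i\<in>I. \<integral>\<^sup>+y. ennreal (w i) * ennreal (h i y) \<partial>M)"
    by (rule nn_integral_sum) (use meas in measurable)
  also have "\<dots> = (\<Sum>i\<in>I. ennreal (w i) * ennreal (m i))"
  proof (rule sum.cong[OF refl])
    fix i assume i: "i \<in> I"
    have "(\<lambda>y. ennreal (h i y)) \<in> borel_measurable M" using meas[OF i] by measurable
    then show "(\<integral>\<^sup>+y. ennreal (w i) * ennreal (h i y) \<partial>M) = ennreal (w i) * ennreal (m i)"
      by (subst nn_integral_cmult) (simp_all add: int[OF i])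
  qed
  also have "\<dots> = (\<Sum>i\<in>I. ennreal (w i * m i))"
    using w m by (intro sum.cong) (auto simp: ennreal_mult)
  also have "\<dots> = ennreal (\<Sum>i\<in>I. w i * m i)"
    using w m by (intro sum_ennreal) auto
  finally show ?thesis .
qed

lemma nn_integral_step_diff:
  fixes a b :: real
  shows "(\<integral>\<^sup>+y. ennreal \<bar>indicator {a..} y - indicator {b..} y\<bar> \<partial>lborel) = ennreal \<bar>a - b\<bar>"
proof -
  have "ennreal \<bar>indicator {a..} y - indicator {b..} y\<bar> = indicator {min a b..<max a b} y" for y
    by (auto simp: indicator_def)
  then have "(\<integral>\<^sup>+y. ennreal \<bar>indicator {a..} y - indicator {b..} y\<bar> \<partial>lborel)
      = emeasure lborel {min a b..<max a b}"
    by simp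
  also have "\<dots> = ennreal (max a b - min a b)" by (rule emeasure_lborel_Ico) simp
  also have "max a b - min a b = \<bar>a - b\<bar>" by simp
  finally show ?thesis .
qed

lemma summation_by_parts:
  fixes c h :: "nat \<Rightarrow> real"
  shows "(\<Sum>j<n. c j * (h j - h (Suc j)))
    = c 0 * h 0 + (\<Sum>j<n. (c (Suc j) - c j) * h (Suc j)) - c n * h n"
  by (induction n) (auto simp: algebra_simps)

text \<open>By summation by parts a step function is a combination of unit steps with its jumps as
  coefficients, and a unit step displaced by \<open>d\<close> changes by \<open>d\<close> in the norm.\<close>

lemma L1_norm_displaced_steps:
  fixes c p q :: "nat \<Rightarrow> real"
  assumes p: "\<And>j. j < n \<Longrightarrow> p j \<le> p (Suc j)" and q: "\<And>j. j < n \<Longrightarrow> q j \<le> q (Suc j)"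
    and d: "\<And>j. j \<le> n \<Longrightarrow> \<bar>p j - q j\<bar> \<le> d" and c: "c n = 0"
  shows "L1_norm (\<lambda>y. (\<Sum>j<n. c j * indicator {p j..<p (Suc j)} y)
      - (\<Sum>j<n. c j * indicator {q j..<q (Suc j)} y))
    \<le> ennreal (d * (\<bar>c 0\<bar> + (\<Sum>j<n. \<bar>c (Suc j) - c j\<bar>)))"
proof -
  let ?step = "\<lambda>p y. indicator {p..} y :: real"
  have steps: "(\<Sum>j<n. c j * indicator {p j..<p (Suc j)} y)
      = c 0 * ?step (p 0) y + (\<Sum>j<n. (c (Suc j) - c j) * ?step (p (Suc j)) y)"
    if "\<And>j. j < n \<Longrightarrow> p j \<le> p (Suc j)" for p :: "nat \<Rightarrow> real" and y
  proof -
    have "(\<Sum>j<n. c j * indicator {p j..<p (Suc j)} y)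
        = (\<Sum>j<n. c j * (?step (p j) y - ?step (p (Suc j)) y))"
    proof (rule sum.cong[OF refl])
      fix j assume "j \<in> {..<n}"
      then have "p j \<le> p (Suc j)" using that by simp
      then show "c j * indicator {p j..<p (Suc j)} y
          = c j * (?step (p j) y - ?step (p (Suc j)) y)"
        by (auto simp: indicator_def)
    qed
    then show ?thesis using summation_by_parts[of c "\<lambda>j. ?step (p j) y" n] c by simp
  qed
  define w where "w = (\<lambda>j. case j of 0 \<Rightarrow> \<bar>c 0\<bar> | Suc i \<Rightarrow> \<bar>c (Suc i) - c i\<bar>)"
  define h where "h = (\<lambda>j y. \<bar>?step (p j) y - ?step (q j) y\<bar>)"
  have w: "0 \<le> w j" for j by (simp add: w_def split: nat.split)
  have "L1_norm (\<lambda>y. (\<Sum>j<n. c j * indicator {p j..<p (Suc j)} y)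
      - (\<Sum>j<n. c j * indicator {q j..<q (Suc j)} y))
    \<le> ennreal (\<Sum>j<Suc n. w j * \<bar>p j - q j\<bar>)"
    unfolding L1_norm_def
  proof (rule nn_integral_abs_le_sum[where h = h])
    show "h j \<in> borel_measurable lborel" for j
      unfolding h_def by measurable
    show "(\<integral>\<^sup>+y. ennreal (h j y) \<partial>lborel) = ennreal \<bar>p j - q j\<bar>" for j
      unfolding h_def by (rule nn_integral_step_diff)
    fix y
    have "(\<Sum>j<n. c j * indicator {p j..<p (Suc j)} y)
        = c 0 * ?step (p 0) y + (\<Sum>j<n. (c (Suc j) - c j) * ?step (p (Suc j)) y)"
      by (rule steps) (rule p)
    moreover have "(\<Sum>j<n. c j * indicator {q j..<q (Suc j)} y)
        = c 0 * ?step (q 0) y + (\<Sum>j<n. (c (Suc j) - c j) * ?step (q (Suc j)) y)"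
      by (rule steps) (rule q)
    ultimately have "(\<Sum>j<n. c j * indicator {p j..<p (Suc j)} y)
          - (\<Sum>j<n. c j * indicator {q j..<q (Suc j)} y)
        = c 0 * (?step (p 0) y - ?step (q 0) y)
          + (\<Sum>j<n. (c (Suc j) - c j) * (?step (p (Suc j)) y - ?step (q (Suc j)) y))"
      by (simp only: right_diff_distrib sum_subtractf)
    also have "\<bar>\<dots>\<bar> \<le> \<bar>c 0 * (?step (p 0) y - ?step (q 0) y)\<bar>
        + (\<Sum>j<n. \<bar>(c (Suc j) - c j) * (?step (p (Suc j)) y - ?step (q (Suc j)) y)\<bar>)"
      by (rule order_trans[OF abs_triangle_ineq add_left_mono[OF sum_abs]])
    also have "\<dots> = w 0 * h 0 y + (\<Sum>j<n. w (Suc j) * h (Suc j) y)"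
      by (simp only: abs_mult w_def h_def nat.case)
    also have "\<dots> = (\<Sum>j<Suc n. w j * h j y)" by (rule sum.lessThan_Suc_shift[symmetric])
    finally show "\<bar>(\<Sum>j<n. c j * indicator {p j..<p (Suc j)} y)
        - (\<Sum>j<n. c j * indicator {q j..<q (Suc j)} y)\<bar> \<le> (\<Sum>j<Suc n. w j * h j y)" .
  qed (auto simp: w h_def)
  also have "(\<Sum>j<Suc n. w j * \<bar>p j - q j\<bar>) \<le> (\<Sum>j<Suc n. w j * d)"
    using d w by (intro sum_mono mult_left_mono) auto
  also have "(\<Sum>j<Suc n. w j * d) = d * (\<bar>c 0\<bar> + (\<Sum>j<n. \<bar>c (Suc j) - c j\<bar>))"
    by (subst sum.lessThan_Suc_shift) (simp add: w_def sum_distrib_left algebra_simps)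
  finally show ?thesis by (simp add: ennreal_leI)
qed

lemma L1_norm_diff_heights:
  fixes c c' p :: "nat \<Rightarrow> real"
  assumes p: "\<And>j. j < n \<Longrightarrow> p j \<le> p (Suc j)"
  shows "L1_norm (\<lambda>y. (\<Sum>j<n. c j * indicator {p j..<p (Suc j)} y)
      - (\<Sum>j<n. c' j * indicator {p j..<p (Suc j)} y))
    \<le> ennreal (\<Sum>j<n. \<bar>c j - c' j\<bar> * (p (Suc j) - p j))"
  unfolding L1_norm_def
proof (rule nn_integral_abs_le_sum[where h = "\<lambda>j. indicator {p j..<p (Suc j)}"])
  fix j assume "j \<in> {..<n}"
  then have le: "p j \<le> p (Suc j)" using p by simp
  then show "(\<integral>\<^sup>+y. ennreal (indicator {p j..<p (Suc j)} y) \<partial>lborel) = ennreal (p (Suc j) - p j)"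
    by (simp add: ennreal_indicator)
  show "0 \<le> p (Suc j) - p j" using le by simp
next
  fix y
  have "(\<Sum>j<n. c j * indicator {p j..<p (Suc j)} y) - (\<Sum>j<n. c' j * indicator {p j..<p (Suc j)} y)
      = (\<Sum>j<n. (c j - c' j) * indicator {p j..<p (Suc j)} y)"
    by (simp only: left_diff_distrib sum_subtractf)
  also have "\<bar>\<dots>\<bar> \<le> (\<Sum>j<n. \<bar>c j - c' j\<bar> * indicator {p j..<p (Suc j)} y)"
    by (rule order_trans[OF sum_abs]) (auto simp: abs_mult)
  finally show "\<bar>(\<Sum>j<n. c j * indicator {p j..<p (Suc j)} y)
      - (\<Sum>j<n. c' j * indicator {p j..<p (Suc j)} y)\<bar>
    \<le> (\<Sum>j<n. \<bar>c j - c' j\<bar> * indicator {p j..<p (Suc j)} y)" .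
qed auto

lemma L1_norm_triangle:
  assumes "f \<in> borel_measurable lborel" "g \<in> borel_measurable lborel" "h \<in> borel_measurable lborel"
  shows "L1_norm (\<lambda>y. f y - h y) \<le> L1_norm (\<lambda>y. f y - g y) + L1_norm (\<lambda>y. g y - h y)"
proof -
  have [measurable]: "f \<in> borel_measurable borel" "g \<in> borel_measurable borel"
    "h \<in> borel_measurable borel"
    using assms by simp_all
  have "L1_norm (\<lambda>y. f y - h y)
      \<le> (\<integral>\<^sup>+y. ennreal \<bar>f y - g y\<bar> + ennreal \<bar>g y - h y\<bar> \<partial>lborel)"
    unfolding L1_norm_def
    by (intro nn_integral_mono) (simp add: ennreal_plus[symmetric] del: ennreal_plus)
  also have "\<dots> = L1_norm (\<lambda>y. f y - g y) + L1_norm (\<lambda>y. g y - h y)"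
    unfolding L1_norm_def by (rule nn_integral_add) measurable
  finally show ?thesis .
qed

lemma (in ftl_pair) L1_norm_density_diff:
  assumes leader: "x N 0 = x' N 0" and t: "0 \<le> t"
  shows "L1_norm (\<lambda>y. eulerian_density N x t y - eulerian_density N x' t y)
    \<le> ennreal (gap_dist 0 * (2 + variation t))"
proof -
  \<comment> \<open>the densities of the first solution placed on the cells of the second\<close>
  define mixed where "mixed = (\<lambda>y. \<Sum>j<N. cell j t * indicator {x' j t..<x' (Suc j) t} y :: real)"
  have ordered: "x j t \<le> x (Suc j) t" "x' j t \<le> x' (Suc j) t" if "j < N" for j
    using position_le[OF t, of j "Suc j"] other.position_le[OF t, of j "Suc j"] that by auto
  have meas: "(\<lambda>y. \<Sum>j<N. c j * indicator {p j..<p (Suc j)} y) \<in> borel_measurable lborel"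
    for c p :: "nat \<Rightarrow> real"
    by measurable
  have "L1_norm (\<lambda>y. eulerian_density N x t y - mixed y)
      \<le> ennreal (gap_dist 0 * (\<bar>cell 0 t\<bar> + (\<Sum>j<N. \<bar>cell (Suc j) t - cell j t\<bar>)))"
    unfolding density_cells mixed_def
    by (rule L1_norm_displaced_steps)
      (auto simp: cell_beyond ordered position_dist[OF leader _ t])
  also have "\<dots> \<le> ennreal (gap_dist 0 * (1 + variation t))"
    using cell_bounds[OF t, of 0] gap_dist_nonneg
    by (intro ennreal_leI mult_left_mono) (auto simp: variation_def)
  finally have displaced: "L1_norm (\<lambda>y. eulerian_density N x t y - mixed y)
      \<le> ennreal (gap_dist 0 * (1 + variation t))" .
  have "(\<Sum>j<N. \<bar>cell j t - other.cell j t\<bar> * (x' (Suc j) t - x' j t)) \<le> gap_dist t"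
    unfolding gap_dist_def other.gap_def[symmetric]
    by (rule sum_mono) (use cell_diff(1)[OF _ t] in simp)
  also have "\<dots> \<le> gap_dist 0" by (rule gap_dist_contraction[OF t])
  finally have "ennreal (\<Sum>j<N. \<bar>cell j t - other.cell j t\<bar> * (x' (Suc j) t - x' j t))
      \<le> ennreal (gap_dist 0)"
    by (rule ennreal_leI)
  moreover have "L1_norm (\<lambda>y. mixed y - eulerian_density N x' t y)
      \<le> ennreal (\<Sum>j<N. \<bar>cell j t - other.cell j t\<bar> * (x' (Suc j) t - x' j t))"
    unfolding other.density_cells mixed_def by (rule L1_norm_diff_heights) (rule ordered(2))
  ultimately have heights: "L1_norm (\<lambda>y. mixed y - eulerian_density N x' t y)
      \<le> ennreal (gap_dist 0)"
    by (rule order_trans[rotated])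
  have "L1_norm (\<lambda>y. eulerian_density N x t y - eulerian_density N x' t y)
      \<le> L1_norm (\<lambda>y. eulerian_density N x t y - mixed y)
        + L1_norm (\<lambda>y. mixed y - eulerian_density N x' t y)"
    unfolding density_cells other.density_cells mixed_def by (intro L1_norm_triangle meas)
  also have "\<dots> \<le> ennreal (gap_dist 0 * (1 + variation t)) + ennreal (gap_dist 0)"
    by (rule add_mono[OF displaced heights])
  also have "\<dots> = ennreal (gap_dist 0 * (1 + variation t) + gap_dist 0)"
    using gap_dist_nonneg[of 0]
    by (intro ennreal_plus[symmetric]) (auto simp: variation_def sum_nonneg)
  also have "gap_dist 0 * (1 + variation t) + gap_dist 0 = gap_dist 0 * (2 + variation t)"
    by (simp add: algebra_simps)
  finally show ?thesis .
qed

section \<open>The Wasserstein distance\<close>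

text \<open>The subgraphs of \<open>F\<close> and the epigraphs of its quantile function \<open>Q\<close> are mirror images, so the
  area between two distribution functions is the area between the quantile functions.\<close>

lemma nn_integral_quantile_diff:
  fixes F F' Q Q' :: "real \<Rightarrow> real"
  assumes [measurable]: "Q \<in> borel_measurable borel" "Q' \<in> borel_measurable borel"
    and Q: "\<And>z y. 0 < z \<Longrightarrow> z \<le> 1 \<Longrightarrow> Q z \<le> y \<longleftrightarrow> z \<le> F y"
    and Q': "\<And>z y. 0 < z \<Longrightarrow> z \<le> 1 \<Longrightarrow> Q' z \<le> y \<longleftrightarrow> z \<le> F' y"
    and F: "\<And>y. 0 \<le> F y" "\<And>y. F y \<le> 1" and F': "\<And>y. 0 \<le> F' y" "\<And>y. F' y \<le> 1"
  shows "(\<integral>\<^sup>+y. ennreal \<bar>F y - F' y\<bar> \<partial>lborel)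
    = (\<integral>\<^sup>+z. ennreal \<bar>Q z - Q' z\<bar> * indicator {0<..1} z \<partial>lborel)"
proof -
  define k :: "real \<Rightarrow> real \<Rightarrow> ennreal" where
    "k = (\<lambda>z y. if 0 < z \<and> z \<le> 1 \<and> (Q z \<le> y \<longleftrightarrow> y < Q' z) then 1 else 0)"
  have "k z y = indicator {min (F y) (F' y)<..max (F y) (F' y)} z" for z y
  proof (cases "0 < z \<and> z \<le> 1")
    case True
    then have "Q z \<le> y \<longleftrightarrow> z \<le> F y" "y < Q' z \<longleftrightarrow> F' y < z"
      using Q[of z y] Q'[of z y] by auto
    then show ?thesis using True by (auto simp: k_def indicator_def)
  next
    case False
    then show ?thesis using F[of y] F'[of y] by (auto simp: k_def indicator_def)
  qed
  then have "(\<integral>\<^sup>+z. k z y \<partial>lborel) = ennreal (max (F y) (F' y) - min (F y) (F' y))" for y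
    by simp
  moreover have "max (F y) (F' y) - min (F y) (F' y) = \<bar>F y - F' y\<bar>" for y by simp
  ultimately have F_eq: "(\<integral>\<^sup>+z. k z y \<partial>lborel) = ennreal \<bar>F y - F' y\<bar>" for y by simp
  have "k z y = indicator {min (Q z) (Q' z)..<max (Q z) (Q' z)} y * indicator {0<..1} z" for z y
    by (auto simp: k_def indicator_def)
  then have "(\<integral>\<^sup>+y. k z y \<partial>lborel)
      = ennreal (max (Q z) (Q' z) - min (Q z) (Q' z)) * indicator {0<..1} z" for z
    by (simp add: nn_integral_multc)
  moreover have "max (Q z) (Q' z) - min (Q z) (Q' z) = \<bar>Q z - Q' z\<bar>" for z by simp
  ultimately have Q_eq: "(\<integral>\<^sup>+y. k z y \<partial>lborel) = ennreal \<bar>Q z - Q' z\<bar> * indicator {0<..1} z" for z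
    by simp
  have "case_prod k \<in> borel_measurable (lborel \<Otimes>\<^sub>M lborel)"
    unfolding k_def by measurable
  from lborel_pair.Fubini'[OF this] show ?thesis
    unfolding F_eq Q_eq .
qed

context ftl
begin

definition cumulative :: "real \<Rightarrow> real \<Rightarrow> real" where
  "cumulative t y = (\<Sum>j<N. cell j t * max 0 (min (x (Suc j) t) y - x j t))"

text \<open>The vehicles are the quantiles at the multiples of \<open>1 / N\<close>, and the quantile function is
  affine in between. Cells closed on the right make it the generalized inverse of \<open>cumulative t\<close> on
  all of \<open>{0<..1}\<close>.\<close>

definition quantile :: "real \<Rightarrow> real \<Rightarrow> real" where
  "quantile t z = (\<Sum>j<N. (x j t + (real N * z - real j) * gap j t)
    * indicator {real j / real N<..real (Suc j) / real N} z)"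

lemma quantile_measurable [measurable]: "quantile t \<in> borel_measurable borel"
  unfolding quantile_def[abs_def] by measurable

lemma level_cell:
  assumes "0 < z" "z \<le> 1"
  obtains j \<theta> where "j < N" "0 < \<theta>" "\<theta> \<le> 1" "z = (real j + \<theta>) / real N"
proof -
  define j where "j = nat (\<lceil>real N * z\<rceil> - 1)"
  have "0 < real N * z" using assms N_pos by simp
  then have "1 \<le> \<lceil>real N * z\<rceil>" by linarith
  then have j: "real j = of_int \<lceil>real N * z\<rceil> - 1" by (simp add: j_def)
  have "real N * z \<le> real N" using assms N_pos by (simp add: mult_left_le)
  then have "\<lceil>real N * z\<rceil> \<le> int N" by (simp add: ceiling_le_iff)
  then have "j < N" using N_ge by (simp add: j_def nat_less_iff)
  moreover have "0 < real N * z - real j" "real N * z - real j \<le> 1" using j by linarith+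
  moreover have "z = (real j + (real N * z - real j)) / real N" using N_pos by simp
  ultimately show thesis by (rule that)
qed

lemma indicator_level:
  assumes "0 < \<theta>" "\<theta> \<le> 1"
  shows "indicator {real i / real N<..real (Suc i) / real N} ((real j + \<theta>) / real N)
    = (if i = j then 1 else 0)"
proof -
  have "(real j + \<theta>) / real N \<in> {real i / real N<..real (Suc i) / real N}
      \<longleftrightarrow> real i < real j + \<theta> \<and> real j + \<theta> \<le> real (Suc i)"
    using N_pos by (simp add: divide_less_cancel divide_le_cancel)
  also have "\<dots> \<longleftrightarrow> i = j" using assms by auto
  finally show ?thesis unfolding indicator_def by simp
qed

lemma quantile_eq:
  assumes j: "j < N" and \<theta>: "0 < \<theta>" "\<theta> \<le> 1"
  shows "quantile t ((real j + \<theta>) / real N) = x j t + \<theta> * gap j t"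
proof -
  have "quantile t ((real j + \<theta>) / real N) = (\<Sum>i<N. if i = j then x j t + \<theta> * gap j t else 0)"
    unfolding quantile_def
    by (rule sum.cong[OF refl]) (use N_pos in \<open>simp add: indicator_level[OF \<theta>] del: of_nat_Suc\<close>)
  also have "\<dots> = x j t + \<theta> * gap j t" using j by simp
  finally show ?thesis .
qed

lemma in_cell:
  assumes t: "0 \<le> t" and j: "j < N" and \<theta>: "0 < \<theta>" "\<theta> \<le> 1"
  shows "x j t < x j t + \<theta> * gap j t" "x j t + \<theta> * gap j t \<le> x (Suc j) t"
proof -
  have "0 < gap j t" by (rule gap_pos[OF j t])
  then show "x j t < x j t + \<theta> * gap j t" using \<theta> by simp
  have "\<theta> * gap j t \<le> 1 * gap j t" using \<open>0 < gap j t\<close> \<theta> by (intro mult_right_mono) auto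
  then show "x j t + \<theta> * gap j t \<le> x (Suc j) t" using gap_def[of j t] by linarith
qed

lemma cumulative_quantile:
  assumes t: "0 \<le> t" and j: "j < N" and \<theta>: "0 < \<theta>" "\<theta> \<le> 1"
  shows "cumulative t (x j t + \<theta> * gap j t) = (real j + \<theta>) / real N"
proof -
  have pos: "0 < gap j t" by (rule gap_pos[OF j t])
  define y where "y = x j t + \<theta> * gap j t"
  have y: "x j t < y" "y \<le> x (Suc j) t"
    unfolding y_def by (rule in_cell[OF t j \<theta>])+
  have "cumulative t y
      = (\<Sum>i<N. (if i < j then 1 / real N else 0) + (if i = j then \<theta> / real N else 0))"
    unfolding cumulative_def
  proof (rule sum.cong[OF refl])
    fix i assume "i \<in> {..<N}"
    then have i: "i < N" by simp
    consider "i < j" | "i = j" | "j < i" by linarith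
    then show "cell i t * max 0 (min (x (Suc i) t) y - x i t)
        = (if i < j then 1 / real N else 0) + (if i = j then \<theta> / real N else 0)"
    proof cases
      case 1
      then have "x (Suc i) t \<le> y" using position_le[OF t, of "Suc i" j] y j by simp
      then show ?thesis
        using 1 gap_pos[OF i t] cell_gap[OF i t] by (simp add: gap_def)
    next
      case 2
      have "cell j t * (\<theta> * gap j t) = \<theta> / real N"
        using cell_gap[OF j t] by (simp add: mult.left_commute)
      then show ?thesis using 2 y pos \<theta> by (simp add: y_def)
    next
      case 3
      then have "y \<le> x i t" using position_le[OF t, of "Suc j" i] y i by simp
      then show ?thesis using 3 by simp
    qed
  qed
  also have "\<dots> = (\<Sum>i<N. if i < j then 1 / real N else 0) + \<theta> / real N"
    using j by (simp add: sum.distrib)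
  also have "(\<Sum>i<N. if i < j then 1 / real N else 0) = real j / real N"
  proof -
    have "{..<N} \<inter> {i. i < j} = {..<j}" using j by auto
    then show ?thesis by (simp add: sum.If_cases)
  qed
  finally show ?thesis by (simp add: y_def add_divide_distrib)
qed

lemma cumulative_mono: "0 \<le> t \<Longrightarrow> y \<le> y' \<Longrightarrow> cumulative t y \<le> cumulative t y'"
  unfolding cumulative_def
  by (intro sum_mono mult_left_mono cell_bounds) auto

lemma cumulative_bounds:
  assumes "0 \<le> t" shows "0 \<le> cumulative t y" "cumulative t y \<le> 1"
proof -
  show "0 \<le> cumulative t y"
    unfolding cumulative_def by (intro sum_nonneg mult_nonneg_nonneg cell_bounds assms) auto
  have "cumulative t y \<le> (\<Sum>j<N. 1 / real N)"
    unfolding cumulative_def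
  proof (rule sum_mono)
    fix j assume "j \<in> {..<N}"
    then have j: "j < N" by simp
    have "cell j t * max 0 (min (x (Suc j) t) y - x j t) \<le> cell j t * gap j t"
      using gap_pos[OF j assms] by (intro mult_left_mono cell_bounds assms) (auto simp: gap_def)
    then show "cell j t * max 0 (min (x (Suc j) t) y - x j t) \<le> 1 / real N"
      using cell_gap[OF j assms] by simp
  qed
  then show "cumulative t y \<le> 1" using N_pos by simp
qed

text \<open>At \<open>q = quantile t z\<close> the distribution function has the value \<open>z\<close>. It is smaller at all points
  left of \<open>q\<close>, because the density is positive on the cell that contains \<open>q\<close> and begins left of it.\<close>

lemma quantile_le_iff:
  assumes t: "0 \<le> t" and z: "0 < z" "z \<le> 1"
  shows "quantile t z \<le> y \<longleftrightarrow> z \<le> cumulative t y"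
proof -
  obtain j \<theta> where j: "j < N" and \<theta>: "0 < \<theta>" "\<theta> \<le> 1" and z_eq: "z = (real j + \<theta>) / real N"
    using level_cell[OF z] .
  define q where "q = x j t + \<theta> * gap j t"
  have q: "quantile t z = q" "cumulative t q = z"
    using quantile_eq[OF j \<theta>] cumulative_quantile[OF t j \<theta>] by (simp_all add: q_def z_eq)
  have q_cell: "x j t < q" "q \<le> x (Suc j) t"
    unfolding q_def by (rule in_cell[OF t j \<theta>])+
  have "cumulative t y < cumulative t q" if "y < q"
    unfolding cumulative_def
  proof (rule sum_strict_mono_ex1)
    show "\<forall>i\<in>{..<N}. cell i t * max 0 (min (x (Suc i) t) y - x i t)
        \<le> cell i t * max 0 (min (x (Suc i) t) q - x i t)"
      using that by (intro ballI mult_left_mono cell_bounds t) auto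
    have "max 0 (min (x (Suc j) t) y - x j t) < max 0 (min (x (Suc j) t) q - x j t)"
      using that q_cell by auto
    then have "cell j t * max 0 (min (x (Suc j) t) y - x j t)
        < cell j t * max 0 (min (x (Suc j) t) q - x j t)"
      by (rule mult_strict_left_mono[OF _ cell_pos[OF j t]])
    then show "\<exists>i\<in>{..<N}. cell i t * max 0 (min (x (Suc i) t) y - x i t)
        < cell i t * max 0 (min (x (Suc i) t) q - x i t)"
      using j by blast
  qed simp
  then show ?thesis
    using q cumulative_mono[OF t, of q y] by (metis not_le)
qed

lemma cdf_density:
  assumes t: "0 \<le> t"
  shows "cdf (density lborel (\<lambda>u. ennreal (eulerian_density N x t u))) y = cumulative t y"
proof -
  have "emeasure (density lborel (\<lambda>u. ennreal (eulerian_density N x t u))) {..y}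
      = (\<integral>\<^sup>+u. ennreal (eulerian_density N x t u) * indicator {..y} u \<partial>lborel)"
    unfolding eulerian_density_def by (rule emeasure_density) auto
  also have "\<dots> = (\<integral>\<^sup>+u. (\<Sum>j<N. ennreal (cell j t)
      * indicator ({x j t..<x (Suc j) t} \<inter> {..y}) u) \<partial>lborel)"
  proof (rule nn_integral_cong)
    fix u
    have "ennreal (eulerian_density N x t u)
        = (\<Sum>j<N. ennreal (cell j t * indicator {x j t..<x (Suc j) t} u))"
      unfolding density_cells
      by (rule sum_ennreal[symmetric]) (use cell_bounds[OF t] in auto)
    also have "\<dots> = (\<Sum>j<N. ennreal (cell j t) * indicator {x j t..<x (Suc j) t} u)"
      by (rule sum.cong) (auto simp: indicator_def)
    finally show "ennreal (eulerian_density N x t u) * indicator {..y} u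
        = (\<Sum>j<N. ennreal (cell j t) * indicator ({x j t..<x (Suc j) t} \<inter> {..y}) u)"
      by (simp only: sum_distrib_right indicator_inter_arith mult.assoc)
  qed
  also have "\<dots> = (\<Sum>j<N. ennreal (cell j t) * emeasure lborel ({x j t..<x (Suc j) t} \<inter> {..y}))"
    by (subst nn_integral_sum) (auto intro!: sum.cong nn_integral_cmult_indicator)
  also have "\<dots> = (\<Sum>j<N. ennreal (cell j t * max 0 (min (x (Suc j) t) y - x j t)))"
  proof (rule sum.cong[OF refl])
    fix j assume "j \<in> {..<N}"
    then have le: "x j t \<le> x (Suc j) t" using position_le[OF t, of j "Suc j"] by simp
    have "emeasure lborel ({x j t..<x (Suc j) t} \<inter> {..y})
        = ennreal (max 0 (min (x (Suc j) t) y - x j t))"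
    proof -
      consider "y < x j t" | "x j t \<le> y" "y < x (Suc j) t" | "x (Suc j) t \<le> y" by linarith
      then show ?thesis
      proof cases
        case 1
        then have "{x j t..<x (Suc j) t} \<inter> {..y} = {}" by auto
        then show ?thesis using 1 by simp
      next
        case 2
        then have "{x j t..<x (Suc j) t} \<inter> {..y} = {x j t..y}" by auto
        then show ?thesis using 2 by simp
      next
        case 3
        then have "{x j t..<x (Suc j) t} \<inter> {..y} = {x j t..<x (Suc j) t}" by auto
        then show ?thesis using 3 le by simp
      qed
    qed
    then show "ennreal (cell j t) * emeasure lborel ({x j t..<x (Suc j) t} \<inter> {..y})
        = ennreal (cell j t * max 0 (min (x (Suc j) t) y - x j t))"
      using cell_bounds[OF t, of j] by (simp add: ennreal_mult)
  qed
  also have "\<dots> = ennreal (cumulative t y)"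
    unfolding cumulative_def by (rule sum_ennreal) (use cell_bounds[OF t] in auto)
  finally show ?thesis
    using cumulative_bounds(1)[OF t] by (simp add: cdf_def measure_def)
qed

end

context ftl_pair
begin

lemma W1_quantile:
  assumes t: "0 \<le> t"
  shows "W1 (eulerian_density N x t) (eulerian_density N x' t)
    = (\<integral>\<^sup>+z. ennreal \<bar>quantile t z - other.quantile t z\<bar> * indicator {0<..1} z \<partial>lborel)"
  unfolding W1_def W1_dist_def cdf_density[OF t] other.cdf_density[OF t]
  by (rule nn_integral_quantile_diff)
    (simp_all add: quantile_le_iff[OF t] other.quantile_le_iff[OF t]
      cumulative_bounds[OF t] other.cumulative_bounds[OF t])

text \<open>Between two vehicles the quantile functions interpolate, so at any level their difference moves
  by at most the displacements of the two neighbouring vehicles, and each displacement is counted in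
  two cells of length \<open>1 / N\<close>.\<close>

lemma W1_growth:
  assumes t: "0 \<le> t"
  shows "W1 (eulerian_density N x t) (eulerian_density N x' t)
    \<le> W1 (eulerian_density N x 0) (eulerian_density N x' 0) + ennreal (2 * L * t * gap_dist 0)"
proof -
  define s where "s = (\<lambda>j. \<bar>shift j t\<bar> + \<bar>shift (Suc j) t\<bar>)"
  define h :: "nat \<Rightarrow> real \<Rightarrow> real" where
    "h = (\<lambda>j. indicator {real j / real N<..real (Suc j) / real N})"
  let ?D = "\<lambda>t z. ennreal \<bar>quantile t z - other.quantile t z\<bar> * indicator {0<..1} z"
  have h_meas [measurable]: "h j \<in> borel_measurable borel" for j
    unfolding h_def by measurable
  have "?D t z \<le> ?D 0 z + ennreal \<bar>\<Sum>j<N. s j * h j z\<bar>" for z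
  proof (cases "0 < z \<and> z \<le> 1")
    case True
    then obtain j \<theta> where j: "j < N" and \<theta>: "0 < \<theta>" "\<theta> \<le> 1" and z_eq: "z = (real j + \<theta>) / real N"
      using level_cell by blast
    have "(\<Sum>i<N. s i * h i z) = (\<Sum>i<N. if i = j then s j else 0)"
      unfolding h_def z_eq
      by (rule sum.cong[OF refl]) (simp add: indicator_level[OF \<theta>] del: of_nat_Suc)
    then have sum: "(\<Sum>i<N. s i * h i z) = s j" using j by simp
    have "quantile t z - other.quantile t z
        = (quantile 0 z - other.quantile 0 z) + ((1 - \<theta>) * shift j t + \<theta> * shift (Suc j) t)"
      unfolding z_eq quantile_eq[OF j \<theta>] other.quantile_eq[OF j \<theta>]
      by (simp add: shift_def gap_def other.gap_def algebra_simps)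
    moreover have "\<bar>(1 - \<theta>) * shift j t\<bar> \<le> \<bar>shift j t\<bar>" "\<bar>\<theta> * shift (Suc j) t\<bar> \<le> \<bar>shift (Suc j) t\<bar>"
      using \<theta> by (auto simp: abs_mult mult_left_le_one_le)
    ultimately have "\<bar>quantile t z - other.quantile t z\<bar>
        \<le> \<bar>quantile 0 z - other.quantile 0 z\<bar> + s j"
      unfolding s_def by linarith
    then have "ennreal \<bar>quantile t z - other.quantile t z\<bar>
        \<le> ennreal (\<bar>quantile 0 z - other.quantile 0 z\<bar> + \<bar>s j\<bar>)"
      by (intro ennreal_leI) (simp add: s_def)
    then show ?thesis using True unfolding sum by simp
  qed simp
  then have "(\<integral>\<^sup>+z. ?D t z \<partial>lborel)
      \<le> (\<integral>\<^sup>+z. ?D 0 z + ennreal \<bar>\<Sum>j<N. s j * h j z\<bar> \<partial>lborel)"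
    by (intro nn_integral_mono)
  also have "\<dots> = (\<integral>\<^sup>+z. ?D 0 z \<partial>lborel) + (\<integral>\<^sup>+z. ennreal \<bar>\<Sum>j<N. s j * h j z\<bar> \<partial>lborel)"
    by (rule nn_integral_add) measurable
  also have "(\<integral>\<^sup>+z. ennreal \<bar>\<Sum>j<N. s j * h j z\<bar> \<partial>lborel) \<le> ennreal (\<Sum>j<N. s j * (1 / real N))"
  proof (rule nn_integral_abs_le_sum)
    show "(\<integral>\<^sup>+z. ennreal (h j z) \<partial>lborel) = ennreal (1 / real N)" for j
    proof -
      have "real j / real N \<le> real (Suc j) / real N" using N_pos by (simp add: divide_right_mono)
      then have "(\<integral>\<^sup>+z. ennreal (h j z) \<partial>lborel) = ennreal (real (Suc j) / real N - real j / real N)"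
        by (simp add: h_def ennreal_indicator)
      also have "real (Suc j) / real N - real j / real N = 1 / real N"
        by (simp add: diff_divide_distrib[symmetric])
      finally show ?thesis .
    qed
    show "\<bar>\<Sum>j<N. s j * h j z\<bar> \<le> (\<Sum>j<N. s j * h j z)" for z
      by (simp add: s_def h_def sum_nonneg)
  qed (auto simp: s_def h_def)
  also have "(\<Sum>j<N. s j * (1 / real N)) \<le> 2 * L * t * gap_dist 0"
  proof -
    have "(\<Sum>j<Suc N. \<bar>shift j t\<bar>) = \<bar>shift 0 t\<bar> + (\<Sum>j<N. \<bar>shift (Suc j) t\<bar>)"
      by (rule sum.lessThan_Suc_shift)
    then have "(\<Sum>j<N. \<bar>shift (Suc j) t\<bar>) \<le> (\<Sum>j<N. \<bar>shift j t\<bar>)"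
      using shift_leader[OF t] by simp
    then have "(\<Sum>j<N. s j) \<le> real N * (2 * L * t * gap_dist 0)"
      using sum_shift_le[OF t] by (simp add: s_def sum.distrib)
    then show ?thesis
      using N_pos by (simp add: sum_divide_distrib[symmetric] field_simps)
  qed
  finally show ?thesis unfolding W1_quantile[OF t] W1_quantile[OF order_refl]
    by (simp add: ennreal_leI add_left_mono)
qed

end

section \<open>Stability\<close>

context ftl_pair
begin

lemma W1_stability:
  assumes t: "0 \<le> t" "t \<le> T"
  shows "W1 (eulerian_density N x t) (eulerian_density N x' t)
    \<le> W1 (eulerian_density N x 0) (eulerian_density N x' 0)
      + ennreal (2 * L * T * gap_diff N x x')"
proof -
  have "2 * L * t * gap_diff N x x' \<le> 2 * L * T * gap_diff N x x'"
    using t L_nonneg gap_dist_nonneg[of 0] unfolding gap_dist_0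
    by (intro mult_right_mono mult_left_mono) auto
  then show ?thesis
    using W1_growth[OF t(1)] unfolding gap_dist_0
    by (meson add_left_mono ennreal_leI order_trans)
qed

lemma L1_stability:
  assumes "x N 0 = x' N 0" "0 \<le> t" "variation t \<le> C"
  shows "L1_norm (\<lambda>y. eulerian_density N x t y - eulerian_density N x' t y)
    \<le> ennreal (gap_diff N x x' * (2 + C))"
proof -
  have "gap_dist 0 * (2 + variation t) \<le> gap_dist 0 * (2 + C)"
    using assms(3) gap_dist_nonneg by (intro mult_left_mono) auto
  then show ?thesis
    using L1_norm_density_diff[OF assms(1,2)] unfolding gap_dist_0
    by (meson ennreal_leI order_trans)
qed

lemma L1_stability_of_TV:
  assumes leader: "x N 0 = x' N 0" and t: "0 \<le> t"
    and TV: "TV (eulerian_density N x 0) < ennreal C"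
  shows "L1_norm (\<lambda>y. eulerian_density N x t y - eulerian_density N x' t y)
    \<le> ennreal (gap_diff N x x' * (2 + C))"
proof (rule L1_stability[OF leader t])
  have "ennreal (variation 0) < ennreal C"
    using variation_le_TV[of 0] TV by (simp add: le_less_trans)
  then have "variation 0 < C" by (simp add: ennreal_less_iff variation_def sum_nonneg)
  then show "variation t \<le> C" using variation_decreasing[OF t] by simp
qed

lemma L1_stability_of_smoothing:
  assumes leader: "x N 0 = x' N 0" and V2: "V2 v" and s: "0 < s" "s \<le> t" and c: "0 < c"
    and slope: "\<And>a b. 0 \<le> a \<Longrightarrow> a \<le> b \<Longrightarrow> b \<le> 1 \<Longrightarrow> v b - v a \<le> - c * (b - a)"
    and span: "x N 0 - x 0 0 \<le> d"
  shows "L1_norm (\<lambda>y. eulerian_density N x t y - eulerian_density N x' t y)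
    \<le> ennreal (gap_diff N x x' * (2 + 2 * (d / s + v 0) / c))"
proof (rule L1_stability[OF leader])
  show "0 \<le> t" using s by simp
  have t: "0 < t" using s by simp
  have "0 \<le> d" using span position_le[of 0 0 N] by simp
  have "(x N 0 - x 0 0) / t \<le> d / t" using span t by (simp add: divide_right_mono)
  also have "\<dots> \<le> d / s" using s \<open>0 \<le> d\<close> by (simp add: frac_le)
  finally have "2 * ((x N 0 - x 0 0) / t + v 0) \<le> 2 * (d / s + v 0)"
    by (intro mult_left_mono add_right_mono) auto
  moreover have "c * variation t \<le> 2 * ((x N 0 - x 0 0) / t + v 0)"
    by (rule variation_smoothing[OF V2 t]) (rule slope)
  ultimately have "c * variation t \<le> 2 * (d / s + v 0)"
    by (rule order_trans[rotated])
  then show "variation t \<le> 2 * (d / s + v 0) / c"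
    using c by (simp add: field_simps)
qed

end

lemma fast_subsequence:
  fixes D :: "nat \<Rightarrow> real"
  assumes D: "D \<longlonglongrightarrow> 0" and e: "\<And>k. 0 < e k"
  obtains r :: "nat \<Rightarrow> nat" where "strict_mono r" "\<And>k. 1 \<le> r k" "\<And>k. D (r k) \<le> e k"
proof -
  have "\<exists>M. \<forall>n\<ge>M. D n \<le> e k" for k
  proof -
    have "\<forall>\<^sub>F n in sequentially. D n < e k" by (rule order_tendstoD(2)[OF D e])
    then show ?thesis by (auto simp: eventually_sequentially intro: less_imp_le)
  qed
  then obtain M where M: "\<And>k n. M k \<le> n \<Longrightarrow> D n \<le> e k" by metis
  define r where "r = (\<lambda>k. Suc k + (\<Sum>i\<le>k. M i))"
  have "strict_mono r" by (rule strict_monoI_Suc) (simp add: r_def)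
  moreover have "M k \<le> r k" for k
    using member_le_sum[of k "{..k}" M] by (simp add: r_def)
  then have "D (r k) \<le> e k" for k by (rule M)
  moreover have "1 \<le> r k" for k by (simp add: r_def)
  ultimately show thesis using that by blast
qed

lemma tendsto_0_ennreal_le:
  fixes f :: "nat \<Rightarrow> ennreal"
  assumes g: "g \<longlonglongrightarrow> 0" and le: "\<And>n. 1 \<le> n \<Longrightarrow> f n \<le> ennreal (g n)"
  shows "f \<longlonglongrightarrow> 0"
proof (rule tendsto_sandwich[of "\<lambda>_. 0" f sequentially "\<lambda>n. ennreal (g n)"])
  show "\<forall>\<^sub>F n in sequentially. f n \<le> ennreal (g n)"
    using eventually_ge_at_top[of 1] by eventually_elim (rule le)
  show "(\<lambda>n. ennreal (g n)) \<longlonglongrightarrow> 0"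
    using tendsto_ennrealI[OF g] by simp
qed auto

theorem theorem1p2:
  fixes v :: "real \<Rightarrow> real" and L :: real and K :: "real set"
    and x x' :: "nat \<Rightarrow> nat \<Rightarrow> real \<Rightarrow> real"
    and \<rho> \<rho>' :: "nat \<Rightarrow> real \<Rightarrow> real \<Rightarrow> real"
  assumes v: "V1 L v"
    and sol: "\<And>N. 1 \<le> N \<Longrightarrow> ftl_solution v N (x N)"
    and sol': "\<And>N. 1 \<le> N \<Longrightarrow> ftl_solution v N (x' N)"
    and K: "bounded K"
    and inK: "\<And>N i. 1 \<le> N \<Longrightarrow> i \<le> N \<Longrightarrow> x N i 0 \<in> K \<and> x' N i 0 \<in> K"
  defines "\<rho> \<equiv> \<lambda>N. eulerian_density N (x N)"
    and "\<rho>' \<equiv> \<lambda>N. eulerian_density N (x' N)"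
  shows
    "(\<forall>T>0. \<forall>N\<ge>1.
        (SUP t\<in>{0..T}. W1 (\<rho> N t) (\<rho>' N t))
          \<le> W1 (\<rho> N 0) (\<rho>' N 0) + ennreal (2 * L * T * gap_diff N (x N) (x' N))) \<and>
     ((\<forall>N\<ge>1. x N N 0 = x' N N 0) \<and> (\<lambda>N. gap_diff N (x N) (x' N)) \<longlonglongrightarrow> 0 \<longrightarrow>
       ((\<exists>C>0. \<forall>N\<ge>1. TV (\<rho> N 0) < ennreal C \<and> TV (\<rho>' N 0) < ennreal C) \<longrightarrow>
         (\<forall>T>0. (\<lambda>N. SUP t\<in>{0..T}. L1_norm (\<lambda>y. \<rho> N t y - \<rho>' N t y)) \<longlonglongrightarrow> 0)) \<and>
       (V2 v \<longrightarrow>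
         (\<forall>T>0. \<exists>r. strict_mono r \<and> (\<forall>k. 1 \<le> r k) \<and>
           (\<lambda>k. SUP t\<in>{1 / real k..T}. L1_norm (\<lambda>y. \<rho> (r k) t y - \<rho>' (r k) t y))
             \<longlonglongrightarrow> 0)))"
proof -
  let ?D = "\<lambda>N. gap_diff N (x N) (x' N)"
  have pair: "ftl_pair v L N (x N) (x' N)" if "1 \<le> N" for N
    using that v sol sol' by (intro ftl_pair.intro ftl.intro)
  have W1: "(SUP t\<in>{0..T}. W1 (\<rho> N t) (\<rho>' N t)) \<le> W1 (\<rho> N 0) (\<rho>' N 0) + ennreal (2 * L * T * ?D N)"
    if "1 \<le> N" for T N
    unfolding \<rho>_def \<rho>'_def
    by (rule SUP_least) (use ftl_pair.W1_stability[OF pair[OF that]] in auto)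
  have TV: "(\<lambda>N. SUP t\<in>{0..T}. L1_norm (\<lambda>y. \<rho> N t y - \<rho>' N t y)) \<longlonglongrightarrow> 0"
    if leader: "\<And>N. 1 \<le> N \<Longrightarrow> x N N 0 = x' N N 0" and D: "?D \<longlonglongrightarrow> 0"
      and C: "\<And>N. 1 \<le> N \<Longrightarrow> TV (\<rho> N 0) < ennreal C" for C T
  proof (rule tendsto_0_ennreal_le)
    show "(\<lambda>N. ?D N * (2 + C)) \<longlonglongrightarrow> 0" using tendsto_mult_left_zero[OF D] .
    show "(SUP t\<in>{0..T}. L1_norm (\<lambda>y. \<rho> N t y - \<rho>' N t y)) \<le> ennreal (?D N * (2 + C))"
      if "1 \<le> N" for N
      using C[OF that] unfolding \<rho>_def \<rho>'_def
      by (intro SUP_least ftl_pair.L1_stability_of_TV[OF pair[OF that] leader[OF that]]) auto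
  qed
  have smoothing: "\<exists>r. strict_mono r \<and> (\<forall>k. 1 \<le> r k) \<and>
      (\<lambda>k. SUP t\<in>{1 / real k..T}. L1_norm (\<lambda>y. \<rho> (r k) t y - \<rho>' (r k) t y)) \<longlonglongrightarrow> 0"
    if leader: "\<And>N. 1 \<le> N \<Longrightarrow> x N N 0 = x' N N 0" and D: "?D \<longlonglongrightarrow> 0"
      and V2: "V2 v" for T
  proof -
    obtain b where "b < 0" and slope: "\<And>p q. 0 \<le> p \<Longrightarrow> p \<le> q \<Longrightarrow> q \<le> 1 \<Longrightarrow> v q - v p \<le> b * (q - p)"
      by (rule V1_decreasing[OF v]) blast
    define c where "c = - b"
    have c: "0 < c" using \<open>b < 0\<close> by (simp add: c_def)
    obtain B where B: "\<And>p. p \<in> K \<Longrightarrow> \<bar>p\<bar> \<le> B"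
      using K by (auto simp: bounded_iff)
    have span: "x N N 0 - x N 0 0 \<le> 2 * B" if "1 \<le> N" for N
      using B[of "x N N 0"] B[of "x N 0 0"] inK[OF that] by auto
    have "0 \<le> B" using B[of "x 1 0 0"] inK[of 1 0] by auto
    have v0: "0 \<le> v 0"
      using ftl.v_0_nonneg[of v L 1 "x 1"] v sol by (simp add: ftl.intro)
    \<comment> \<open>on \<open>{1 / k..T}\<close> the variation is of order \<open>k\<close>, so the gap difference has to beat \<open>1 / k\<close>\<close>
    obtain r where r: "strict_mono r" "\<And>k. 1 \<le> r k" "\<And>k. ?D (r k) \<le> (inverse (real (Suc k)))\<^sup>2"
      by (rule fast_subsequence[OF D, of "\<lambda>k. (inverse (real (Suc k)))\<^sup>2"]) auto
    define A where "A = 2 + 2 * (2 * B + v 0) / c"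
    have "0 \<le> A" using \<open>0 \<le> B\<close> v0 c by (simp add: A_def)
    have "(\<lambda>k. SUP t\<in>{1 / real k..T}. L1_norm (\<lambda>y. \<rho> (r k) t y - \<rho>' (r k) t y)) \<longlonglongrightarrow> 0"
    proof (rule tendsto_0_ennreal_le)
      show "(\<lambda>k. A * inverse (real (Suc k))) \<longlonglongrightarrow> 0"
        using tendsto_mult_right_zero[OF LIMSEQ_inverse_real_of_nat] .
      fix k :: nat assume k: "1 \<le> k"
      have "2 + 2 * (2 * B / (1 / real k) + v 0) / c \<le> A * real (Suc k)"
      proof -
        have "2 * B * real k + v 0 \<le> (2 * B + v 0) * real (Suc k)"
          using \<open>0 \<le> B\<close> v0 by (simp add: algebra_simps)
        then have "2 * (2 * B * real k + v 0) / c \<le> 2 * ((2 * B + v 0) * real (Suc k)) / c"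
          using c by (intro divide_right_mono) auto
        moreover have "2 \<le> 2 * real (Suc k)" by simp
        moreover have "A * real (Suc k)
            = 2 * real (Suc k) + 2 * ((2 * B + v 0) * real (Suc k)) / c"
          unfolding A_def distrib_right times_divide_eq_left mult.assoc ..
        moreover have "2 * B / (1 / real k) = 2 * B * real k" by simp
        ultimately show ?thesis by (simp only: add_mono)
      qed
      then have "?D (r k) * (2 + 2 * (2 * B / (1 / real k) + v 0) / c)
          \<le> (inverse (real (Suc k)))\<^sup>2 * (A * real (Suc k))"
        using \<open>0 \<le> B\<close> v0 c by (intro mult_mono r(3)) auto
      also have "\<dots> = A * inverse (real (Suc k))"
        by (simp add: power2_eq_square field_simps del: of_nat_Suc)
      finally have "ennreal (?D (r k) * (2 + 2 * (2 * B / (1 / real k) + v 0) / c))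
          \<le> ennreal (A * inverse (real (Suc k)))"
        by (rule ennreal_leI)
      moreover have "(SUP t\<in>{1 / real k..T}. L1_norm (\<lambda>y. \<rho> (r k) t y - \<rho>' (r k) t y))
          \<le> ennreal (?D (r k) * (2 + 2 * (2 * B / (1 / real k) + v 0) / c))"
        unfolding \<rho>_def \<rho>'_def
      proof (rule SUP_least)
        fix t assume t: "t \<in> {1 / real k..T}"
        show "L1_norm (\<lambda>y. eulerian_density (r k) (x (r k)) t y - eulerian_density (r k) (x' (r k)) t y)
            \<le> ennreal (?D (r k) * (2 + 2 * (2 * B / (1 / real k) + v 0) / c))"
        proof (rule ftl_pair.L1_stability_of_smoothing[OF pair[OF r(2)] leader[OF r(2)] V2 _ _ c])
          show "v q - v p \<le> - c * (q - p)" if "0 \<le> p" "p \<le> q" "q \<le> 1" for p q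
            using slope[OF that] by (simp add: c_def)
          show "x (r k) (r k) 0 - x (r k) 0 0 \<le> 2 * B" by (rule span[OF r(2)])
        qed (use k t in auto)
      qed
      ultimately show "(SUP t\<in>{1 / real k..T}. L1_norm (\<lambda>y. \<rho> (r k) t y - \<rho>' (r k) t y))
          \<le> ennreal (A * inverse (real (Suc k)))"
        by (rule order_trans[rotated])
    qed
    with r(1,2) show ?thesis by blast
  qed
  show ?thesis
  proof (intro conjI impI allI; (elim conjE exE)?)
    fix T :: real and N :: nat assume "1 \<le> N"
    then show "(SUP t\<in>{0..T}. W1 (\<rho> N t) (\<rho>' N t))
        \<le> W1 (\<rho> N 0) (\<rho>' N 0) + ennreal (2 * L * T * ?D N)"
      by (rule W1)
  next
    fix T C
    assume "\<forall>N\<ge>1. x N N 0 = x' N N 0" "?D \<longlonglongrightarrow> 0"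
      "\<forall>N\<ge>1. TV (\<rho> N 0) < ennreal C \<and> TV (\<rho>' N 0) < ennreal C"
    then show "(\<lambda>N. SUP t\<in>{0..T}. L1_norm (\<lambda>y. \<rho> N t y - \<rho>' N t y)) \<longlonglongrightarrow> 0"
      by (intro TV) auto
  next
    fix T assume "\<forall>N\<ge>1. x N N 0 = x' N N 0" "?D \<longlonglongrightarrow> 0" "V2 v"
    then show "\<exists>r. strict_mono r \<and> (\<forall>k. 1 \<le> r k) \<and>
        (\<lambda>k. SUP t\<in>{1 / real k..T}. L1_norm (\<lambda>y. \<rho> (r k) t y - \<rho>' (r k) t y)) \<longlonglongrightarrow> 0"
      by (intro smoothing) auto
  qed
qed

end
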